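(* Every Banach lattice with the Positive Schur Property has the weak Banach-Saks property.
   Context: A Banach lattice $X$ has the Positive Schur Property if every sequence $(x_n)$ in $X$ with $x_n\ge 0$ for all $n$ and $x_n\to 0$ weakly satisfies $\|x_n\|\to 0$. A Banach space has the weak Banach-Saks property if every weakly null sequence has a subsequence $(y_n)$ whose Cesàro means $\frac1n\sum_{k=1}^n y_k$ converge in norm. *)

theory Defs
  imports "HOL-Analysis.Analysis" "HOL-Library.Lattice_Algebras"
begin

text \<open>
  Real Banach lattices. The modulus is \<open>\<bar>x\<bar> = sup x (- x)\<close>, by the library class
  \<^class>\<open>lattice_ab_group_add_abs\<close>.
\<close>

class banach_lattice = banach + ordered_real_vector + lattice_ab_group_add_abs +
  assumes norm_mono_abs: "\<bar>x\<bar> \<le> \<bar>y\<bar> \<Longrightarrow> norm x \<le> norm y"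

definition weakly_convergent_to :: "(nat \<Rightarrow> 'a::real_normed_vector) \<Rightarrow> 'a \<Rightarrow> bool" where
  "weakly_convergent_to x l \<longleftrightarrow>
     (\<forall>f :: 'a \<Rightarrow> real. bounded_linear f \<longrightarrow> (\<lambda>n. f (x n)) \<longlonglongrightarrow> f l)"

definition positive_schur_property :: "'a::banach_lattice itself \<Rightarrow> bool" where
  "positive_schur_property _ \<longleftrightarrow>
     (\<forall>x :: nat \<Rightarrow> 'a. (\<forall>n. 0 \<le> x n) \<longrightarrow> weakly_convergent_to x 0 \<longrightarrow>
        (\<lambda>n. norm (x n)) \<longlonglongrightarrow> 0)"

text \<open>
  Sequences are indexed from 0, so the \<open>n\<close>-th mean is over the indices \<open>k < n\<close>; the
  term for \<open>n = 0\<close> is 0 and does not affect convergence.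
\<close>

definition cesaro_mean :: "(nat \<Rightarrow> 'a::real_vector) \<Rightarrow> nat \<Rightarrow> 'a" where
  "cesaro_mean y n = (1 / real n) *\<^sub>R (\<Sum>k<n. y k)"

definition weak_banach_saks_property :: "'a::banach itself \<Rightarrow> bool" where
  "weak_banach_saks_property _ \<longleftrightarrow>
     (\<forall>x :: nat \<Rightarrow> 'a. weakly_convergent_to x 0 \<longrightarrow>
        (\<exists>r :: nat \<Rightarrow> nat. strict_mono r \<and> convergent (cesaro_mean (x \<circ> r))))"

end

theory Submission
  imports Defs
begin

text \<open>
  Given a weakly null sequence \<open>x\<close>, a gliding hump argument shows that disjoint positive sequences
  dominated by \<open>x\<close> are weakly null, so the Positive Schur Property makes \<open>x\<close> almost order bounded:
  up to small norm, every \<open>\<bar>x n\<bar>\<close> lies below a multiple of a single \<open>W \<ge> 0\<close>. The property also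
  yields one positive functional \<open>f\<close> that detects norm convergence to 0 on \<open>{0..W}\<close>. It thus suffices
  to make \<open>f \<bar>S n\<bar> = o(n)\<close> for the partial sums \<open>S n\<close> of a subsequence. In \<open>L\<^sup>2\<close> one would choose the
  terms almost orthogonal to the earlier partial sums; here the square is replaced by a sum of
  functions \<open>(s - m u)\<^sup>+\<close>, and orthogonality by smallness of the new term on the functionals that
  \<open>f\<close> induces on the bands generated by the \<open>(\<plusminus> S n - l W)\<^sup>+\<close>.
\<close>

section \<open>Banach lattices\<close>


text \<open>The elements need not be functions and \<open>S n\<close> may have no square, so the
  argument runs on one functional \<open>f\<close> and the order alone. With \<open>L\<close> levels
  the potential is \<open>\<Psi> s = \<Sum>m<L. f (pprt (s - (m+1) u))\<close>: it behaves like a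
  square up to height about \<open>L u\<close> and has slope at most \<open>L\<close> beyond. Adding
  a term dominated by \<open>u\<close> changes \<open>\<Psi>\<close> by a linear expression plus at
  most \<open>f u\<close>, whatever \<open>L\<close> is, whereas \<open>L * f (pprt s)\<close>
  exceeds \<open>\<Psi> s\<close> by at most \<open>L * L * f u\<close>, a constant. After division
  by \<open>L\<close> a step therefore costs about \<open>f u / L\<close>, and \<open>L\<close> is
  free; this gives \<open>o(n)\<close>. Both \<open>u\<close> and \<open>L\<close> depend on the
  accuracy wanted, but the subsequence is chosen before any accuracy is fixed. For this reason all
  majorants are multiples of one \<open>W\<close>: every level is then some \<open>l W\<close>, and
  the \<open>n\<close>-th choice only has to treat the finitely many \<open>l \<le> n\<close>. The
  functional \<open>f\<close> exists because the Schur property forces increasing order bounded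
  sequences to converge in norm, which stands in for monotone convergence.\<close>

lemma norm_mono_nonneg:
  fixes x y :: "'a::banach_lattice"
  assumes "0 \<le> x" "x \<le> y"
  shows "norm x \<le> norm y"
  using assms by (intro norm_mono_abs) (metis abs_of_nonneg order_trans)

lemma norm_abs: "norm \<bar>x :: 'a::banach_lattice\<bar> = norm x"
  by (intro order.antisym norm_mono_abs) simp_all

lemma pprt_minus_pprt_uminus: "pprt x - pprt (- x) = (x::'a::lattice_ab_group_add)"
  using prts[of x] by (simp add: pprt_neg)

lemma pprt_plus_pprt_uminus: "pprt x + pprt (- x) = \<bar>x::'a::lattice_ab_group_add_abs\<bar>"
  by (simp add: pprt_neg abs_prts)

lemma pprt_ge_self: "(x::'a::lattice_ab_group_add) \<le> pprt x"
  by (simp add: pprt_def)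

lemma pprt_leI: "(x::'a::lattice_ab_group_add) \<le> y \<Longrightarrow> 0 \<le> y \<Longrightarrow> pprt x \<le> y"
  by (simp add: pprt_def)

lemma pprt_le_abs: "pprt (x::'a::lattice_ab_group_add_abs) \<le> \<bar>x\<bar>"
  by (intro pprt_leI abs_ge_self abs_ge_zero)

lemma pprt_add_le: "pprt (x + y) \<le> pprt x + pprt (y::'a::lattice_ab_group_add)"
  by (intro pprt_leI add_mono pprt_ge_self) simp

lemma norm_pprt_le: "norm (pprt (x::'a::banach_lattice)) \<le> norm x"
  by (rule norm_mono_abs) (simp add: pprt_le_abs)

lemma pprt_scaleR:
  fixes x :: "'a::banach_lattice"
  assumes "0 \<le> c"
  shows "pprt (c *\<^sub>R x) = c *\<^sub>R pprt x"
proof (cases "c = 0")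
  case False
  with assms have c: "0 < c" by simp
  show ?thesis
  proof (rule order.antisym)
    show "pprt (c *\<^sub>R x) \<le> c *\<^sub>R pprt x"
      using assms by (intro pprt_leI scaleR_left_mono pprt_ge_self scaleR_nonneg_nonneg) auto
    have "x = (1/c) *\<^sub>R (c *\<^sub>R x)" using c by simp
    also have "\<dots> \<le> (1/c) *\<^sub>R pprt (c *\<^sub>R x)"
      using c by (intro scaleR_left_mono pprt_ge_self) auto
    finally have "pprt x \<le> (1/c) *\<^sub>R pprt (c *\<^sub>R x)"
      using c by (intro pprt_leI scaleR_nonneg_nonneg) auto
    then have "c *\<^sub>R pprt x \<le> c *\<^sub>R ((1/c) *\<^sub>R pprt (c *\<^sub>R x))"
      using c by (intro scaleR_left_mono) auto
    then show "c *\<^sub>R pprt x \<le> pprt (c *\<^sub>R x)" using c by simp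
  qed
qed simp

lemma inf_pprt_pprt_uminus: "inf (pprt x) (pprt (- x)) = (0::'a::lattice_ab_group_add)"
proof -
  have "inf (pprt x) (pprt (- x)) = inf x 0 + pprt (- x)"
    unfolding add_inf_distrib_right using pprt_minus_pprt_uminus[of x]
    by (metis add.commute add_0 diff_add_cancel)
  also have "\<dots> = 0" by (simp only: pprt_neg nprt_def right_minus)
  finally show ?thesis .
qed

lemma diff_inf_eq_pprt: "x - inf x y = pprt (x - (y::'a::lattice_ab_group_add))"
  by (simp add: pprt_def add_sup_distrib_left sup_commute)

text \<open>The positive cone is norm closed because \<open>pprt\<close> is monotone: the negative
  part of the limit lies below \<open>pprt (s n - l)\<close>, whose norm tends to 0.\<close>

lemma nonneg_limit:
  fixes s :: "nat \<Rightarrow> 'a::banach_lattice"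
  assumes "s \<longlonglongrightarrow> l" and "\<And>n. 0 \<le> s n"
  shows "0 \<le> l"
proof -
  have "norm (pprt (- l)) \<le> norm (s n - l)" for n
  proof -
    have "pprt (- l) \<le> pprt (s n - l)" using assms(2)[of n] by (intro pprt_mono) simp
    then have "norm (pprt (- l)) \<le> norm (pprt (s n - l))" by (intro norm_mono_nonneg) auto
    also have "\<dots> \<le> norm (s n - l)" by (rule norm_pprt_le)
    finally show ?thesis .
  qed
  moreover have "(\<lambda>n. norm (s n - l)) \<longlonglongrightarrow> 0"
    using assms(1) by (simp add: LIM_zero tendsto_norm_zero)
  ultimately have "norm (pprt (- l)) \<le> 0" by (meson LIMSEQ_le_const)
  then have "pprt (- l) = 0" by simp
  then show ?thesis using pprt_minus_pprt_uminus[of l] by (metis diff_zero zero_le_pprt)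
qed

lemma limit_le:
  fixes s :: "nat \<Rightarrow> 'a::banach_lattice"
  assumes "s \<longlonglongrightarrow> l" "t \<longlonglongrightarrow> m" and "\<And>n. s n \<le> t n"
  shows "l \<le> m"
  using nonneg_limit[OF tendsto_diff[OF assms(2,1)]] assms(3) by simp

lemma inf_add_le:
  fixes a b c :: "'a::lattice_ab_group_add"
  assumes "0 \<le> a" "0 \<le> b" "0 \<le> c"
  shows "inf (a + b) c \<le> inf a c + inf b c"
proof -
  have "inf (a + b) c - inf a c \<le> b"
  proof -
    have "inf (a + b) c \<le> inf a c + b"
      unfolding add_inf_distrib_right using assms by (simp add: le_infI2 add_increasing2)
    then show ?thesis by (simp only: diff_le_eq add.commute)
  qed
  moreover have "inf (a + b) c - inf a c \<le> c"
  proof -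
    have "inf (a + b) c \<le> c + inf a c" using assms by (simp add: le_infI2 add_increasing2)
    then show ?thesis by (simp only: diff_le_eq)
  qed
  ultimately have "inf (a + b) c - inf a c \<le> inf b c" by (rule inf_greatest)
  then show ?thesis by (simp only: diff_le_eq add.commute)
qed

lemma inf_scaleR_eq_0:
  fixes v x :: "'a::banach_lattice"
  assumes "inf v x = 0" "0 \<le> k"
  shows "inf (k *\<^sub>R v) x = 0"
proof -
  have v: "0 \<le> v" and x: "0 \<le> x" using assms(1) by (metis inf_le1, metis inf_le2)
  \<comment> \<open>Scaling by \<open>1 / (k + 1)\<close> instead of \<open>1 / k\<close> covers
    \<open>k = 0\<close> and puts the scaled element below \<open>x\<close> as well as below
    \<open>v\<close>.\<close>
  let ?y = "inf (k *\<^sub>R v) x" and ?c = "k + 1"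
  have y0: "0 \<le> ?y" using v x assms(2) by (simp add: scaleR_nonneg_nonneg)
  have "(1 / ?c) *\<^sub>R ?y \<le> (1 / ?c) *\<^sub>R (?c *\<^sub>R v)"
    using assms(2) v by (intro scaleR_left_mono) (auto intro!: le_infI1 scaleR_right_mono)
  then have "(1 / ?c) *\<^sub>R ?y \<le> v" using assms(2) by simp
  moreover have "(1 / ?c) *\<^sub>R ?y \<le> 1 *\<^sub>R ?y"
    using assms(2) y0 by (intro scaleR_right_mono) (auto simp: field_simps)
  then have "(1 / ?c) *\<^sub>R ?y \<le> x" by (metis inf_le2 order_trans scaleR_one)
  ultimately have "(1 / ?c) *\<^sub>R ?y \<le> 0" using assms(1) by (metis inf_greatest)
  moreover have "0 \<le> (1 / ?c) *\<^sub>R ?y" using assms(2) y0 by (intro scaleR_nonneg_nonneg) auto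
  ultimately have "(1 / ?c) *\<^sub>R ?y = 0" by (rule order.antisym)
  then show ?thesis using assms(2) by simp
qed

lemma disjoint_mono:
  fixes a b a' b' :: "'a::lattice_ab_group_add"
  assumes "inf a' b' = 0" "0 \<le> a" "0 \<le> b" "a \<le> a'" "b \<le> b'"
  shows "inf a b = 0"
  using assms by (metis inf_greatest inf_mono order.antisym)

lemma tendsto_norm_zero_bound:
  fixes s :: "nat \<Rightarrow> 'a::real_normed_vector"
  assumes "\<And>n. norm (s n) \<le> t n" "t \<longlonglongrightarrow> (0::real)"
  shows "s \<longlonglongrightarrow> 0"
  by (rule Lim_null_comparison[OF _ assms(2)]) (simp add: assms(1))

section \<open>Restricting a functional to an ideal\<close>

definition positive_functional :: "('a::banach_lattice \<Rightarrow> real) \<Rightarrow> bool" where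
  "positive_functional f \<longleftrightarrow> bounded_linear f \<and> (\<forall>x\<ge>0. 0 \<le> f x)"

text \<open>The positive part of an order ideal; its elements are the competitors in the supremum
  below.\<close>

definition solid_cone :: "'a::banach_lattice set \<Rightarrow> bool" where
  "solid_cone I \<longleftrightarrow> 0 \<in> I \<and> (\<forall>x\<in>I. 0 \<le> x) \<and> (\<forall>x\<in>I. \<forall>y\<in>I. x + y \<in> I) \<and>
     (\<forall>c\<ge>0. \<forall>x\<in>I. c *\<^sub>R x \<in> I) \<and> (\<forall>x\<in>I. \<forall>y. 0 \<le> y \<longrightarrow> y \<le> x \<longrightarrow> y \<in> I)"

lemma solid_coneD:
  assumes "solid_cone I"
  shows "0 \<in> I" "x \<in> I \<Longrightarrow> 0 \<le> x" "x \<in> I \<Longrightarrow> y \<in> I \<Longrightarrow> x + y \<in> I"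
    "0 \<le> c \<Longrightarrow> x \<in> I \<Longrightarrow> c *\<^sub>R x \<in> I" "x \<in> I \<Longrightarrow> 0 \<le> y \<Longrightarrow> y \<le> x \<Longrightarrow> y \<in> I"
  using assms unfolding solid_cone_def by blast+

text \<open>A Riesz-Kantorovich formula, meant for \<open>0 \<le> x\<close>. For the whole positive
  cone it gives the positive part of \<open>f\<close>; for a principal ideal and positive
  \<open>f\<close> it gives the component of \<open>f\<close> carried by that ideal.\<close>

definition restrict_sup :: "'a::banach_lattice set \<Rightarrow> ('a \<Rightarrow> real) \<Rightarrow> 'a \<Rightarrow> real" where
  "restrict_sup I f x = (SUP y\<in>{y \<in> I. y \<le> x}. f y)"

definition restrict_functional :: "'a::banach_lattice set \<Rightarrow> ('a \<Rightarrow> real) \<Rightarrow> 'a \<Rightarrow> real" where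
  "restrict_functional I f x = restrict_sup I f (pprt x) - restrict_sup I f (pprt (- x))"

context
  fixes I :: "'a::banach_lattice set" and f :: "'a \<Rightarrow> real"
  assumes I: "solid_cone I" and f: "bounded_linear f"
begin

interpretation bounded_linear f by (rule f)

lemma restrict_sup_bdd: "bdd_above (f ` {y \<in> I. y \<le> x})"
proof -
  obtain K where K: "\<And>x. norm (f x) \<le> norm x * K" "0 \<le> K" using nonneg_bounded by blast
  have "f y \<le> norm x * K" if "y \<in> I" "y \<le> x" for y
  proof -
    have "norm y \<le> norm x" using I that unfolding solid_cone_def by (intro norm_mono_nonneg) auto
    then have "norm y * K \<le> norm x * K" using K by (intro mult_right_mono) auto
    then show ?thesis using K(1)[of y] by auto
  qed
  then show ?thesis by (auto simp: bdd_above_def)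
qed

lemma restrict_sup_upper: "y \<in> I \<Longrightarrow> y \<le> x \<Longrightarrow> f y \<le> restrict_sup I f x"
  unfolding restrict_sup_def by (intro cSUP_upper restrict_sup_bdd) simp

lemma restrict_sup_least:
  assumes "0 \<le> x" "\<And>y. y \<in> I \<Longrightarrow> y \<le> x \<Longrightarrow> f y \<le> b"
  shows "restrict_sup I f x \<le> b"
  unfolding restrict_sup_def
proof (rule cSUP_least)
  show "{y \<in> I. y \<le> x} \<noteq> {}" using I assms(1) by (auto simp: solid_cone_def)
qed (use assms in auto)

lemma restrict_sup_nonneg: "0 \<le> x \<Longrightarrow> 0 \<le> restrict_sup I f x"
  using restrict_sup_upper[of 0 x] I by (simp add: solid_cone_def zero)

text \<open>Riesz decomposition: a competitor \<open>z\<close> below \<open>x + y\<close> splits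
  into \<open>inf z x\<close> and a remainder below \<open>y\<close>, and solidity keeps both in
  \<open>I\<close>. Conversely, competitors for \<open>x\<close> and \<open>y\<close> add
  up.\<close>

lemma restrict_sup_add:
  assumes x: "0 \<le> x" and y: "0 \<le> y"
  shows "restrict_sup I f (x + y) = restrict_sup I f x + restrict_sup I f y"
proof (rule order.antisym)
  show "restrict_sup I f (x + y) \<le> restrict_sup I f x + restrict_sup I f y"
  proof (rule restrict_sup_least)
    fix z assume z: "z \<in> I" "z \<le> x + y"
    have z0: "0 \<le> z" using z I by (auto simp: solid_cone_def)
    let ?a = "inf z x"
    have a0: "0 \<le> ?a" using z0 x by simp
    have b0: "0 \<le> z - ?a" "z - ?a \<le> z" using a0 by (simp_all only: diff_ge_0_iff_ge inf_le1 diff_le_eq le_add_same_cancel1)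
    have "?a \<in> I" "z - ?a \<in> I"
      using I z(1) a0 b0 inf_le1[of z x] unfolding solid_cone_def by blast+
    moreover have "z - ?a \<le> y"
      unfolding diff_inf_eq_pprt using z y by (intro pprt_leI) (auto simp: algebra_simps)
    ultimately have "f ?a + f (z - ?a) \<le> restrict_sup I f x + restrict_sup I f y"
      by (intro add_mono restrict_sup_upper) auto
    then show "f z \<le> restrict_sup I f x + restrict_sup I f y"
      unfolding diff by linarith
  qed (use assms in simp)
  have "f z \<le> restrict_sup I f (x + y) - restrict_sup I f y" if z: "z \<in> I" "z \<le> x" for z
  proof -
    have "restrict_sup I f y \<le> restrict_sup I f (x + y) - f z"
    proof (rule restrict_sup_least[OF y])
      fix w assume w: "w \<in> I" "w \<le> y"
      have "f (z + w) \<le> restrict_sup I f (x + y)"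
        by (intro restrict_sup_upper add_mono solid_coneD(3)[OF I] z w)
      then show "f w \<le> restrict_sup I f (x + y) - f z" by (simp add: add)
    qed
    then show ?thesis by simp
  qed
  from restrict_sup_least[OF x this]
  show "restrict_sup I f x + restrict_sup I f y \<le> restrict_sup I f (x + y)" by simp
qed

lemma restrict_sup_scaleR:
  assumes c: "0 \<le> c" and x: "0 \<le> x"
  shows "restrict_sup I f (c *\<^sub>R x) = c * restrict_sup I f x"
proof (cases "c = 0")
  case True
  have "restrict_sup I f 0 = 0" using restrict_sup_add[of 0 0] by simp
  then show ?thesis using True by simp
next
  case False
  have le: "restrict_sup I f (d *\<^sub>R z) \<le> d * restrict_sup I f z" if "0 < d" "0 \<le> z" for d z
  proof (rule restrict_sup_least)
    fix y assume y: "y \<in> I" "y \<le> d *\<^sub>R z"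
    have "(1/d) *\<^sub>R y \<le> (1/d) *\<^sub>R (d *\<^sub>R z)" using that y by (intro scaleR_left_mono) auto
    then have "f ((1/d) *\<^sub>R y) \<le> restrict_sup I f z"
      using that y by (intro restrict_sup_upper solid_coneD(4)[OF I]) auto
    then show "f y \<le> d * restrict_sup I f z" using that by (simp add: scaleR field_simps)
  qed (use that in \<open>simp add: scaleR_nonneg_nonneg\<close>)
  have "restrict_sup I f ((1/c) *\<^sub>R (c *\<^sub>R x)) \<le> (1/c) * restrict_sup I f (c *\<^sub>R x)"
    using c False x by (intro le) (auto simp: scaleR_nonneg_nonneg)
  then have "c * restrict_sup I f x \<le> restrict_sup I f (c *\<^sub>R x)"
    using c False by (simp add: field_simps)
  with le[of c x] c False x show ?thesis by simp
qed

text \<open>The value does not depend on how an element is written as a difference of positive ones,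
  by additivity on the cone. Linearity reduces to this independence.\<close>

lemma restrict_functional_diff:
  assumes "0 \<le> a" "0 \<le> b"
  shows "restrict_functional I f (a - b) = restrict_sup I f a - restrict_sup I f b"
proof -
  have "pprt (a - b) + b = a + pprt (- (a - b))"
    using pprt_minus_pprt_uminus[of "a - b"] by (simp add: algebra_simps)
  then have "restrict_sup I f (pprt (a - b) + b) = restrict_sup I f (a + pprt (- (a - b)))"
    by simp
  then show ?thesis using assms by (simp add: restrict_sup_add restrict_functional_def)
qed

lemma restrict_functional_nonneg_eq: "0 \<le> a \<Longrightarrow> restrict_functional I f a = restrict_sup I f a"
  using restrict_functional_diff[of a 0] restrict_sup_scaleR[of 0 0] by simp

lemma linear_restrict_functional: "linear (restrict_functional I f)"
proof (rule linearI)
  fix x y :: 'a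
  have "x + y = (pprt x + pprt y) - (pprt (- x) + pprt (- y))"
    using pprt_minus_pprt_uminus[of x] pprt_minus_pprt_uminus[of y] by (simp add: algebra_simps)
  then show "restrict_functional I f (x + y) = restrict_functional I f x + restrict_functional I f y"
    by (metis (no_types, lifting) restrict_functional_diff restrict_functional_def restrict_sup_add
        add_diff_add add_nonneg_nonneg zero_le_pprt)
next
  fix c and x :: 'a
  show "restrict_functional I f (c *\<^sub>R x) = c *\<^sub>R restrict_functional I f x"
  proof (cases "0 \<le> c")
    case True
    have "c *\<^sub>R x = c *\<^sub>R pprt x - c *\<^sub>R pprt (- x)"
      by (metis pprt_minus_pprt_uminus scaleR_diff_right)
    then have "restrict_functional I f (c *\<^sub>R x) = restrict_sup I f (c *\<^sub>R pprt x) - restrict_sup I f (c *\<^sub>R pprt (- x))"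
      using True by (metis restrict_functional_diff scaleR_nonneg_nonneg zero_le_pprt)
    then show ?thesis
      using True by (simp add: restrict_functional_def restrict_sup_scaleR right_diff_distrib)
  next
    case False
    have "c *\<^sub>R x = (- c) *\<^sub>R pprt (- x) - (- c) *\<^sub>R pprt x"
      by (metis pprt_minus_pprt_uminus scaleR_diff_right minus_diff_eq scaleR_minus_left)
    then have "restrict_functional I f (c *\<^sub>R x) = restrict_sup I f ((- c) *\<^sub>R pprt (- x)) - restrict_sup I f ((- c) *\<^sub>R pprt x)"
      using False restrict_functional_diff[of "(- c) *\<^sub>R pprt (- x)" "(- c) *\<^sub>R pprt x"]
      by (metis linorder_le_cases neg_0_le_iff_le scaleR_nonneg_nonneg zero_le_pprt)
    then show ?thesis
      using False by (simp only: restrict_functional_def restrict_sup_scaleR zero_le_pprt real_scaleR_def)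
        (simp add: restrict_sup_scaleR algebra_simps)
  qed
qed

lemma positive_restrict_functional: "positive_functional (restrict_functional I f)"
proof -
  obtain K where K: "\<And>x. norm (f x) \<le> norm x * K" "0 \<le> K" using nonneg_bounded by blast
  have b: "restrict_sup I f z \<le> norm x * K" if z: "0 \<le> z" "z \<le> \<bar>x\<bar>" for x z
  proof (rule restrict_sup_least[OF z(1)])
    fix y assume y: "y \<in> I" "y \<le> z"
    have "0 \<le> y" using y I by (auto simp: solid_cone_def)
    then have "norm y \<le> norm x"
      using y z by (intro norm_mono_abs) auto
    then have "norm y * K \<le> norm x * K" using K by (intro mult_right_mono) auto
    then show "f y \<le> norm x * K" using K(1)[of y] by auto
  qed
  have "bounded_linear (restrict_functional I f)"
  proof (rule bounded_linear_intro)
    fix x y :: 'a and r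
    show "restrict_functional I f (x + y) = restrict_functional I f x + restrict_functional I f y"
      by (rule linear_add[OF linear_restrict_functional])
    show "restrict_functional I f (r *\<^sub>R x) = r *\<^sub>R restrict_functional I f x"
      by (rule linear_scale[OF linear_restrict_functional])
    have "restrict_sup I f (pprt x) \<le> norm x * K" "restrict_sup I f (pprt (- x)) \<le> norm x * K"
      using pprt_le_abs[of x] pprt_le_abs[of "- x"] by (auto intro!: b)
    moreover have "0 \<le> restrict_sup I f (pprt x)" "0 \<le> restrict_sup I f (pprt (- x))"
      by (simp_all add: restrict_sup_nonneg)
    ultimately show "norm (restrict_functional I f x) \<le> norm x * K"
      unfolding restrict_functional_def by auto
  qed
  then show ?thesis
    unfolding positive_functional_def
    by (simp add: restrict_functional_nonneg_eq restrict_sup_nonneg)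
qed

end

section \<open>Positive functionals and their components on bands\<close>

lemma positive_functional_mono:
  assumes "positive_functional f" "x \<le> y"
  shows "f x \<le> f y"
proof -
  have "0 \<le> f (y - x)" using assms unfolding positive_functional_def by simp
  then show ?thesis
    using assms(1) by (simp add: positive_functional_def linear_diff bounded_linear.linear)
qed

lemma positive_functional_abs_le:
  assumes "positive_functional f"
  shows "\<bar>f x\<bar> \<le> f \<bar>x\<bar>"
proof -
  have "f (- x) = - f x"
    using assms by (simp add: positive_functional_def linear_neg bounded_linear.linear)
  moreover have "f x \<le> f \<bar>x\<bar>" "f (- x) \<le> f \<bar>x\<bar>"
    by (rule positive_functional_mono[OF assms abs_ge_self], rule positive_functional_mono[OF assms abs_ge_minus_self])
  ultimately show ?thesis by linarith
qed

lemma solid_cone_nonneg: "solid_cone {x::'a::banach_lattice. 0 \<le> x}"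
  by (auto simp: solid_cone_def scaleR_nonneg_nonneg)

text \<open>A bounded functional is a difference of two positive ones: \<open>?g\<close> is its
  positive part, and \<open>?g - f\<close> is positive because \<open>y\<close> itself competes in
  the supremum that defines \<open>?g y\<close>.\<close>

lemma weakly_null_positiveI:
  fixes x :: "nat \<Rightarrow> 'a::banach_lattice"
  assumes "\<And>f. positive_functional f \<Longrightarrow> (\<lambda>n. f (x n)) \<longlonglongrightarrow> 0"
  shows "weakly_convergent_to x 0"
  unfolding weakly_convergent_to_def
proof (intro allI impI)
  fix f :: "'a \<Rightarrow> real" assume f: "bounded_linear f"
  let ?I = "{x::'a. 0 \<le> x}"
  let ?g = "restrict_functional ?I f"
  have g: "positive_functional ?g" by (rule positive_restrict_functional[OF solid_cone_nonneg f])
  have "f y \<le> ?g y" if "0 \<le> y" for y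
    using that by (simp add: restrict_functional_nonneg_eq[OF solid_cone_nonneg f]
        restrict_sup_upper[OF solid_cone_nonneg f])
  then have h: "positive_functional (\<lambda>y. ?g y - f y)"
    using g f by (auto simp: positive_functional_def bounded_linear_sub)
  have "(\<lambda>n. ?g (x n) - (?g (x n) - f (x n))) \<longlonglongrightarrow> 0 - 0"
    by (intro tendsto_diff assms[OF g] assms[OF h])
  then show "(\<lambda>n. f (x n)) \<longlonglongrightarrow> f 0" using f by (simp add: linear_0 bounded_linear.linear)
qed

text \<open>This plays the role of integration over the set \<open>{v > 0}\<close>.\<close>

definition band_functional :: "('a::banach_lattice \<Rightarrow> real) \<Rightarrow> 'a \<Rightarrow> 'a \<Rightarrow> real" where
  "band_functional f v = restrict_functional {y. 0 \<le> y \<and> (\<exists>k\<ge>0. y \<le> k *\<^sub>R v)} f"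

lemma solid_cone_principal:
  fixes v :: "'a::banach_lattice"
  assumes "0 \<le> v"
  shows "solid_cone {y. 0 \<le> y \<and> (\<exists>k\<ge>0. y \<le> k *\<^sub>R v)}"
  unfolding solid_cone_def
proof (intro conjI ballI allI impI; clarsimp)
  show "\<exists>k\<ge>0. 0 \<le> k *\<^sub>R v" by (rule exI[of _ 0]) simp
next
  fix x y :: 'a and k l :: real
  assume "0 \<le> k" "x \<le> k *\<^sub>R v" "0 \<le> l" "y \<le> l *\<^sub>R v"
  then show "\<exists>k\<ge>0. x + y \<le> k *\<^sub>R v"
    by (intro exI[of _ "k + l"]) (simp add: scaleR_add_left add_mono)
next
  fix c k :: real and x :: 'a
  assume "0 \<le> c" "0 \<le> k" "0 \<le> x" "x \<le> k *\<^sub>R v"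
  then show "0 \<le> c *\<^sub>R x \<and> (\<exists>k\<ge>0. c *\<^sub>R x \<le> k *\<^sub>R v)"
    using scaleR_left_mono[of x "k *\<^sub>R v" c]
    by (auto simp: scaleR_nonneg_nonneg intro!: exI[of _ "c * k"])
next
  fix x y :: 'a and k :: real
  assume "0 \<le> k" "x \<le> k *\<^sub>R v" "y \<le> x"
  then show "\<exists>k\<ge>0. y \<le> k *\<^sub>R v" by (meson order_trans)
qed

lemma positive_band_functional:
  assumes "positive_functional f" "0 \<le> v"
  shows "positive_functional (band_functional f v)"
  unfolding band_functional_def
  by (rule positive_restrict_functional[OF solid_cone_principal[OF assms(2)]])
    (use assms(1) in \<open>simp add: positive_functional_def\<close>)

lemma band_functional_upper:
  assumes "positive_functional f" "0 \<le> v" "0 \<le> y" "y \<le> k *\<^sub>R v" "0 \<le> k" "y \<le> x"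
  shows "f y \<le> band_functional f v x"
proof -
  have bl: "bounded_linear f" using assms by (simp add: positive_functional_def)
  show ?thesis
    unfolding band_functional_def using assms
    by (subst restrict_functional_nonneg_eq[OF solid_cone_principal bl])
      (auto intro!: restrict_sup_upper[OF solid_cone_principal bl])
qed

lemma band_functional_least:
  assumes "positive_functional f" "0 \<le> v" "0 \<le> x"
    and "\<And>y k. 0 \<le> y \<Longrightarrow> y \<le> k *\<^sub>R v \<Longrightarrow> 0 \<le> k \<Longrightarrow> y \<le> x \<Longrightarrow> f y \<le> b"
  shows "band_functional f v x \<le> b"
proof -
  have bl: "bounded_linear f" using assms by (simp add: positive_functional_def)
  show ?thesis
    unfolding band_functional_def using assms
    by (subst restrict_functional_nonneg_eq[OF solid_cone_principal bl])
      (auto intro!: restrict_sup_least[OF solid_cone_principal bl])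
qed

lemma band_functional_nonneg:
  assumes "positive_functional f" "0 \<le> v" "0 \<le> x"
  shows "0 \<le> band_functional f v x"
  using positive_band_functional[OF assms(1,2)] assms(3) by (simp add: positive_functional_def)

lemma band_functional_le:
  assumes "positive_functional f" "0 \<le> v" "0 \<le> x"
  shows "band_functional f v x \<le> f x"
  by (rule band_functional_least[OF assms]) (rule positive_functional_mono[OF assms(1)])

lemma band_functional_mono:
  assumes "positive_functional f" "0 \<le> v" "v \<le> w" "0 \<le> x"
  shows "band_functional f v x \<le> band_functional f w x"
proof (rule band_functional_least[OF assms(1,2,4)])
  fix y :: 'a and k :: real
  assume y: "0 \<le> y" "y \<le> k *\<^sub>R v" "0 \<le> k" "y \<le> x"
  have "y \<le> k *\<^sub>R w" using y assms(3) by (meson order_trans scaleR_left_mono)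
  then show "f y \<le> band_functional f w x"
    using y assms by (intro band_functional_upper[of f w y k]) auto
qed

lemma band_functional_disjoint:
  assumes "positive_functional f" "inf v x = 0"
  shows "band_functional f v x = 0"
proof -
  have v: "0 \<le> v" and x: "0 \<le> x" using assms(2) by (metis inf_le1, metis inf_le2)
  have "band_functional f v x \<le> 0"
  proof (rule band_functional_least[OF assms(1) v x])
    fix y :: 'a and k :: real
    assume y: "0 \<le> y" "y \<le> k *\<^sub>R v" "0 \<le> k" "y \<le> x"
    have "y \<le> 0" using y inf_scaleR_eq_0[OF assms(2) y(3)] by (metis inf_greatest)
    then have "y = 0" using y by simp
    then show "f y \<le> 0"
      using assms(1) by (simp add: positive_functional_def linear_0 bounded_linear.linear)
  qed
  with band_functional_nonneg[OF assms(1) v x] show ?thesis by simp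
qed

text \<open>Competitors \<open>y\<close> and \<open>z\<close> for the two bands are disjoint, so
  \<open>y + z = sup y z\<close> is still below the same \<open>x\<close> and competes for the band
  of \<open>v + w\<close>.\<close>

lemma band_functional_add_disjoint:
  assumes f: "positive_functional f" and vw: "inf v w = 0" and x: "0 \<le> x"
  shows "band_functional f v x + band_functional f w x \<le> band_functional f (v + w) x"
proof -
  have v: "0 \<le> v" and w: "0 \<le> w" using vw by (metis inf_le1, metis inf_le2)
  have fadd: "f (a + b) = f a + f b" for a b
    using f by (simp add: positive_functional_def linear_add bounded_linear.linear)
  have "f y \<le> band_functional f (v + w) x - band_functional f w x"
    if y: "0 \<le> y" "y \<le> k *\<^sub>R v" "0 \<le> k" "y \<le> x" for y k
  proof -
    have "band_functional f w x \<le> band_functional f (v + w) x - f y"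
    proof (rule band_functional_least[OF f w x])
      fix z :: 'a and l :: real
      assume z: "0 \<le> z" "z \<le> l *\<^sub>R w" "0 \<le> l" "z \<le> x"
      have "inf (k *\<^sub>R v) (l *\<^sub>R w) = 0"
        using vw y(3) z(3) by (metis inf_commute inf_scaleR_eq_0)
      then have "inf y z = 0"
        by (rule disjoint_mono[OF _ y(1) z(1) y(2) z(2)])
      then have "y + z = sup y z" using add_eq_inf_sup[of y z] by simp
      then have "y + z \<le> x" using y z by simp
      moreover have "y + z \<le> (k + l) *\<^sub>R (v + w)"
      proof -
        have "y + z \<le> k *\<^sub>R v + l *\<^sub>R w" using y z by (intro add_mono)
        also have "\<dots> \<le> (k + l) *\<^sub>R v + (k + l) *\<^sub>R w"
          using y z v w by (intro add_mono scaleR_right_mono) auto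
        finally show ?thesis by (simp add: scaleR_add_right)
      qed
      ultimately have "f (y + z) \<le> band_functional f (v + w) x"
        using y z v w by (intro band_functional_upper[OF f, of "v + w" "y + z" "k + l"]) auto
      then show "f z \<le> band_functional f (v + w) x - f y" by (simp add: fadd)
    qed
    then show ?thesis by simp
  qed
  then have "band_functional f v x \<le> band_functional f (v + w) x - band_functional f w x"
    by (intro band_functional_least[OF f v x])
  then show ?thesis by simp
qed

text \<open>Integrating \<open>b\<close> over \<open>{b > 0}\<close>: the negative part is disjoint
  from \<open>pprt b\<close> and contributes nothing, while \<open>pprt b\<close> is its own best
  competitor.\<close>

lemma band_functional_pprt_self:
  assumes "positive_functional f"
  shows "band_functional f (pprt b) b = f (pprt b)"
proof -
  let ?G = "band_functional f (pprt b)"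
  have G: "positive_functional ?G" using assms by (rule positive_band_functional) simp
  have "?G b = ?G (pprt b) - ?G (pprt (- b))"
    using G pprt_minus_pprt_uminus[of b]
    by (metis positive_functional_def bounded_linear.linear linear_diff)
  also have "?G (pprt (- b)) = 0"
    by (rule band_functional_disjoint[OF assms inf_pprt_pprt_uminus])
  also have "?G (pprt b) = f (pprt b)"
    using band_functional_upper[OF assms, of "pprt b" "pprt b" 1 "pprt b"]
      band_functional_le[OF assms, of "pprt b" "pprt b"] by simp
  finally show ?thesis by simp
qed


section \<open>The Hahn--Banach theorem\<close>

definition sublinear :: "('a::real_vector \<Rightarrow> real) \<Rightarrow> bool" where
  "sublinear p \<longleftrightarrow> (\<forall>x y. p (x + y) \<le> p x + p y) \<and> (\<forall>c\<ge>0. \<forall>x. p (c *\<^sub>R x) \<le> c * p x)"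

lemma sublinear_add: "sublinear p \<Longrightarrow> p (x + y) \<le> p x + p y"
  by (simp add: sublinear_def)

lemma sublinear_zero:
  assumes "sublinear p"
  shows "p 0 = 0"
proof -
  have "p (0 *\<^sub>R 0) \<le> 0 * p 0" using assms unfolding sublinear_def by blast
  with sublinear_add[OF assms, of 0 0] show ?thesis by simp
qed

lemma sublinear_scale:
  assumes "sublinear p" "0 \<le> c"
  shows "p (c *\<^sub>R x) = c * p x"
proof (cases "c = 0")
  case True
  then show ?thesis by (simp add: sublinear_zero[OF assms(1)])
next
  case False
  have "p ((1/c) *\<^sub>R (c *\<^sub>R x)) \<le> (1/c) * p (c *\<^sub>R x)"
    using assms unfolding sublinear_def by (metis divide_nonneg_nonneg zero_le_one)
  then have "c * p x \<le> p (c *\<^sub>R x)" using False assms(2) by (simp add: field_simps)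
  moreover have "p (c *\<^sub>R x) \<le> c * p x" using assms by (simp add: sublinear_def)
  ultimately show ?thesis by simp
qed

lemma sublinear_uminus_ge:
  assumes "sublinear p"
  shows "- p (- x) \<le> p x"
  using sublinear_add[OF assms, of x "- x"] sublinear_zero[OF assms] by simp

text \<open>Zorn's lemma for the reversed pointwise order. The infimum of a chain is finite because
  each member satisfies \<open>- r (- x) \<le> q x\<close>; subadditivity survives because any two
  members of the chain have a smaller one among them.\<close>

lemma sublinear_minimal_exists:
  fixes r :: "'a::real_vector \<Rightarrow> real"
  assumes "sublinear r"
  obtains q where "sublinear q" "\<And>x. q x \<le> r x"
    "\<And>p. sublinear p \<Longrightarrow> (\<And>x. p x \<le> q x) \<Longrightarrow> p = q"
proof -
  define A where "A = {q. sublinear q \<and> q \<le> r}"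
  have "\<exists>m\<in>A. \<forall>a\<in>A. a \<le> m \<longrightarrow> a = m"
  proof (rule predicate_Zorn)
    show "partial_order_on A (relation_of (\<lambda>x y. y \<le> x) A)"
      by (rule partial_order_on_relation_ofI) auto
    fix C assume C: "C \<in> Chains (relation_of (\<lambda>x y. y \<le> x) A)"
    then have CA: "C \<subseteq> A" and Cch: "\<And>a b. a \<in> C \<Longrightarrow> b \<in> C \<Longrightarrow> a \<le> b \<or> b \<le> a"
      unfolding Chains_def relation_of_def by auto
    show "\<exists>u\<in>A. \<forall>a\<in>C. u \<le> a"
    proof (cases "C = {}")
      case True
      then show ?thesis using assms by (auto simp: A_def)
    next
      case False
      have sub: "sublinear q" if "q \<in> C" for q using CA that by (auto simp: A_def)
      define u where "u = (\<lambda>x. INF q\<in>C. q x)"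
      have "bdd_below ((\<lambda>q. q x) ` C)" for x
      proof -
        have "- r (- x) \<le> q x" if "q \<in> C" for q
        proof -
          have "q (- x) \<le> r (- x)" using CA that by (auto simp: A_def le_fun_def)
          with sublinear_uminus_ge[OF sub[OF that], of x] show ?thesis by simp
        qed
        then show ?thesis by (auto simp: bdd_below_def)
      qed
      then have u_le: "u x \<le> q x" if "q \<in> C" for q x
        unfolding u_def using that by (intro cINF_lower)
      have u_ge: "b \<le> u x" if "\<And>q. q \<in> C \<Longrightarrow> b \<le> q x" for b x
        unfolding u_def using that False by (intro cINF_greatest) auto
      have "sublinear u"
        unfolding sublinear_def
      proof (intro conjI allI impI)
        fix x y
        have "u (x + y) - q2 y \<le> q1 x" if q12: "q1 \<in> C" "q2 \<in> C" for q1 q2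
        proof -
          obtain q where "q \<in> C" "q \<le> q1" "q \<le> q2" using Cch[OF q12] q12 order.refl by metis
          then have "u (x + y) \<le> q x + q y" "q x \<le> q1 x" "q y \<le> q2 y"
            using u_le[of q "x + y"] sublinear_add[OF sub, of q x y] by (auto simp: le_fun_def)
          then show ?thesis by simp
        qed
        then have "u (x + y) - q2 y \<le> u x" if "q2 \<in> C" for q2
          using that by (intro u_ge)
        then have "u (x + y) - u x \<le> q2 y" if "q2 \<in> C" for q2
          using that by (simp add: algebra_simps)
        then have "u (x + y) - u x \<le> u y" by (intro u_ge)
        then show "u (x + y) \<le> u x + u y" by simp
      next
        fix c :: real and x assume c: "0 \<le> c"
        show "u (c *\<^sub>R x) \<le> c * u x"
        proof (cases "c = 0")
          case True
          obtain q where "q \<in> C" using False by blast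
          then show ?thesis using u_le[of q 0] sublinear_zero[OF sub[of q]] True by simp
        next
          case c0: False
          have "u (c *\<^sub>R x) / c \<le> q x" if "q \<in> C" for q
            using u_le[OF that, of "c *\<^sub>R x"] sublinear_scale[OF sub[OF that] c, of x] c c0
            by (simp add: field_simps)
          then have "u (c *\<^sub>R x) / c \<le> u x" by (intro u_ge)
          then show ?thesis using c c0 by (simp add: field_simps)
        qed
      qed
      moreover have "u \<le> r"
      proof -
        obtain q where q: "q \<in> C" using False by blast
        then have "q \<le> r" using CA by (auto simp: A_def)
        then show ?thesis using u_le[OF q] by (meson le_funI order_trans le_funD)
      qed
      ultimately have "u \<in> A" by (simp add: A_def)
      then show ?thesis using u_le by (auto simp: le_fun_def)
    qed
  qed
  then obtain q where q: "q \<in> A" "\<And>a. a \<in> A \<Longrightarrow> a \<le> q \<Longrightarrow> a = q" by blast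
  show ?thesis
  proof (rule that[of q])
    show "sublinear q" "q x \<le> r x" for x using q(1) by (auto simp: A_def le_fun_def)
    fix p assume p: "sublinear p" "\<And>x. p x \<le> q x"
    have "p \<le> q" using p(2) by (rule le_funI)
    moreover have "q \<le> r" using q(1) by (simp add: A_def)
    ultimately show "p = q" using p(1) by (intro q(2)) (simp_all add: A_def)
  qed
qed

text \<open>The values \<open>t = 0\<close> and \<open>t = 1\<close> in the infimum give the two
  bounds, and \<open>- p (- x)\<close> bounds it from below. At \<open>x = - z\<close> the second
  bound reads \<open>q (- z) \<le> - p z\<close>, which later pins down the value at
  \<open>z\<close>.\<close>

lemma sublinear_shift:
  fixes p :: "'a::real_vector \<Rightarrow> real"
  assumes p: "sublinear p"
  obtains q where "sublinear q" "\<And>x. q x \<le> p x" "\<And>x. q x \<le> p (x + z) - p z"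
proof -
  define q where "q = (\<lambda>x. INF t\<in>{0..}. p (x + t *\<^sub>R z) - t * p z)"
  have "bdd_below ((\<lambda>t. p (x + t *\<^sub>R z) - t * p z) ` {0..})" for x
  proof -
    have "- p (- x) \<le> p (x + t *\<^sub>R z) - t * p z" if "0 \<le> t" for t
      using sublinear_add[OF p, of "- x" "x + t *\<^sub>R z"] sublinear_scale[OF p that, of z] by simp
    then show ?thesis by (auto simp: bdd_below_def)
  qed
  then have q_le: "q x \<le> p (x + t *\<^sub>R z) - t * p z" if "0 \<le> t" for t x
    unfolding q_def using that by (intro cINF_lower) auto
  have q_ge: "b \<le> q x" if "\<And>t. 0 \<le> t \<Longrightarrow> b \<le> p (x + t *\<^sub>R z) - t * p z" for b x
    unfolding q_def using that by (intro cINF_greatest) auto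
  have "sublinear q"
    unfolding sublinear_def
  proof (intro conjI allI impI)
    fix x y
    have "q (x + y) - (p (y + s *\<^sub>R z) - s * p z) \<le> p (x + t *\<^sub>R z) - t * p z"
      if "0 \<le> t" "0 \<le> s" for t s
      using q_le[of "t + s" "x + y"] sublinear_add[OF p, of "x + t *\<^sub>R z" "y + s *\<^sub>R z"] that
      by (simp add: algebra_simps)
    then have "q (x + y) - (p (y + s *\<^sub>R z) - s * p z) \<le> q x" if "0 \<le> s" for s
      using that by (intro q_ge)
    then have "q (x + y) - q x \<le> p (y + s *\<^sub>R z) - s * p z" if "0 \<le> s" for s
      using that by (simp add: algebra_simps)
    then have "q (x + y) - q x \<le> q y" by (intro q_ge)
    then show "q (x + y) \<le> q x + q y" by simp
  next
    fix c :: real and x assume c: "0 \<le> c"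
    show "q (c *\<^sub>R x) \<le> c * q x"
    proof (cases "c = 0")
      case True
      then show ?thesis using q_le[of 0 0] by (simp add: sublinear_zero[OF p])
    next
      case c0: False
      have "q (c *\<^sub>R x) / c \<le> p (x + t *\<^sub>R z) - t * p z" if "0 \<le> t" for t
      proof -
        have "q (c *\<^sub>R x) \<le> p (c *\<^sub>R (x + t *\<^sub>R z)) - c * t * p z"
          using q_le[of "c * t" "c *\<^sub>R x"] c that by (simp add: scaleR_add_right)
        also have "p (c *\<^sub>R (x + t *\<^sub>R z)) = c * p (x + t *\<^sub>R z)"
          by (rule sublinear_scale[OF p c])
        finally have "q (c *\<^sub>R x) \<le> (p (x + t *\<^sub>R z) - t * p z) * c"
          by (simp add: algebra_simps)
        then show ?thesis using c c0 by (simp add: pos_divide_le_eq)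
      qed
      then have "q (c *\<^sub>R x) / c \<le> q x" by (intro q_ge)
      then show ?thesis using c c0 by (simp add: field_simps)
    qed
  qed
  then show ?thesis using q_le[of 0] q_le[of 1] by (intro that[of q]) auto
qed

text \<open>A minimal sublinear functional is linear, since its shifts are sublinear and smaller.\<close>

theorem hahn_banach_sublinear:
  fixes p :: "'a::real_vector \<Rightarrow> real"
  assumes p: "sublinear p"
  obtains f where "linear f" "\<And>x. f x \<le> p x" "f z = p z"
proof -
  obtain r where r: "sublinear r" "\<And>x. r x \<le> p x" "\<And>x. r x \<le> p (x + z) - p z"
    using sublinear_shift[OF p] by metis
  obtain q where q: "sublinear q" "\<And>x. q x \<le> r x"
      "\<And>p. sublinear p \<Longrightarrow> (\<And>x. p x \<le> q x) \<Longrightarrow> p = q"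
    using sublinear_minimal_exists[OF r(1)] by metis
  have "q x + q y \<le> q (x + y)" for x y
  proof -
    obtain s where s: "sublinear s" "\<And>x. s x \<le> q x" "\<And>x. s x \<le> q (x + y) - q y"
      using sublinear_shift[OF q(1)] by metis
    have "s = q" using s by (intro q(3))
    then show ?thesis using s(3)[of x] by simp
  qed
  with sublinear_add[OF q(1)] have add: "q (x + y) = q x + q y" for x y
    by (simp add: order.antisym)
  have neg: "q (- x) = - q x" for x
    using add[of x "- x"] sublinear_zero[OF q(1)] by simp
  have "linear q"
  proof (rule linearI)
    fix c and x :: 'a
    show "q (c *\<^sub>R x) = c *\<^sub>R q x"
    proof (cases "0 \<le> c")
      case False
      then show ?thesis
        using neg[of "(- c) *\<^sub>R x"] sublinear_scale[OF q(1), of "- c" x] by simp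
    qed (simp add: sublinear_scale[OF q(1)])
  qed (rule add)
  \<comment> \<open>Since \<open>r\<close> was shifted at \<open>z\<close> before minimising,
    \<open>- q z = q (- z) \<le> p 0 - p z\<close>.\<close>
  moreover have "q z = p z"
    using q(2)[of "- z"] r(3)[of "- z"] q(2)[of z] r(2)[of z] sublinear_zero[OF p]
    by (simp add: neg)
  ultimately show ?thesis using q(2) r(2) by (intro that[of q]) (auto intro: order_trans)
qed

lemma norming_functional:
  fixes z :: "'a::real_normed_vector"
  obtains f where "bounded_linear f" "\<And>x. \<bar>f x\<bar> \<le> norm x" "f z = norm z"
proof -
  have "sublinear (norm :: 'a \<Rightarrow> real)"
    by (simp add: sublinear_def norm_triangle_ineq)
  then obtain f :: "'a \<Rightarrow> real" where f: "linear f" "\<And>x. f x \<le> norm x" "f z = norm z"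
    by (rule hahn_banach_sublinear[where z = z]) blast
  have b: "\<bar>f x\<bar> \<le> norm x" for x
    using f(2)[of x] f(2)[of "- x"] linear_neg[OF f(1), of x] by simp
  moreover have "bounded_linear f"
    using f(1) b by (intro bounded_linear_intro[where K=1]) (auto simp: linear_add linear_scale)
  ultimately show ?thesis using f(3) by (intro that)
qed

text \<open>Hahn-Banach is applied to the norm of the positive part instead of the norm. This
  majorant vanishes on negative elements, which forces \<open>f\<close> to be positive.\<close>

lemma positive_norming_functional:
  fixes z :: "'a::banach_lattice"
  assumes "0 \<le> z"
  obtains f where "positive_functional f" "\<And>x. \<bar>f x\<bar> \<le> norm x" "f z = norm z"
proof -
  have "sublinear (\<lambda>x::'a. norm (pprt x))"
    unfolding sublinear_def
  proof (intro conjI allI impI)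
    fix x y :: 'a
    have "norm (pprt (x + y)) \<le> norm (pprt x + pprt y)"
      by (intro norm_mono_nonneg pprt_add_le zero_le_pprt)
    also have "\<dots> \<le> norm (pprt x) + norm (pprt y)" by (rule norm_triangle_ineq)
    finally show "norm (pprt (x + y)) \<le> norm (pprt x) + norm (pprt y)" .
  qed (simp add: pprt_scaleR)
  then obtain f :: "'a \<Rightarrow> real" where f: "linear f" "\<And>x. f x \<le> norm (pprt x)" "f z = norm (pprt z)"
    by (rule hahn_banach_sublinear[where z = z]) blast
  have b: "\<bar>f x\<bar> \<le> norm x" for x
    using f(2)[of x] f(2)[of "- x"] linear_neg[OF f(1), of x] norm_pprt_le[of x] norm_pprt_le[of "- x"]
    by simp
  have "bounded_linear f"
    using f(1) b by (intro bounded_linear_intro[where K=1]) (auto simp: linear_add linear_scale)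
  moreover have "0 \<le> f x" if "0 \<le> x" for x
    using f(2)[of "- x"] linear_neg[OF f(1), of x] that by simp
  ultimately show ?thesis
    using b f(3) assms by (intro that[of f]) (auto simp: positive_functional_def)
qed

section \<open>Series of functionals and boundedness of weakly null sequences\<close>

lemma summable_abs_functionals:
  fixes g :: "nat \<Rightarrow> 'a::real_normed_vector \<Rightarrow> real"
  assumes "\<And>n x. (\<Sum>j<n. \<bar>g j x\<bar>) \<le> norm x * K"
  shows "summable (\<lambda>j. \<bar>g j x\<bar>)"
  by (rule summableI_nonneg_bounded[OF _ assms]) simp

lemma bounded_linear_suminf_functionals:
  fixes g :: "nat \<Rightarrow> 'a::real_normed_vector \<Rightarrow> real"
  assumes g: "\<And>j. linear (g j)" and K: "\<And>n x. (\<Sum>j<n. \<bar>g j x\<bar>) \<le> norm x * K"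
  shows "bounded_linear (\<lambda>x. \<Sum>j. g j x)"
proof (rule bounded_linear_intro)
  note s = summable_abs_functionals[of g, OF K]
  note s' = summable_rabs_cancel[OF s]
  fix x y :: 'a and r :: real
  show "(\<Sum>j. g j (x + y)) = (\<Sum>j. g j x) + (\<Sum>j. g j y)"
    by (simp add: linear_add[OF g] suminf_add[OF s' s'])
  show "(\<Sum>j. g j (r *\<^sub>R x)) = r *\<^sub>R (\<Sum>j. g j x)"
    by (simp add: linear_scale[OF g] suminf_mult[OF s'])
  have "norm (\<Sum>j. g j x) \<le> (\<Sum>j. \<bar>g j x\<bar>)" using summable_rabs[OF s] by simp
  also have "\<dots> \<le> norm x * K" by (rule suminf_le_const[OF s K])
  finally show "norm (\<Sum>j. g j x) \<le> norm x * K" .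
qed

text \<open>Uniform boundedness by direct construction: if norms exceed \<open>k * 4 ^ k\<close>
  along \<open>y\<close>, a series of norming functionals with coefficients \<open>0\<close> or
  \<open>1 / 4 ^ k\<close> is unbounded along \<open>y\<close>, although its values on a weakly null
  sequence converge.\<close>

lemma weakly_null_bounded:
  fixes x :: "nat \<Rightarrow> 'a::real_normed_vector"
  assumes x: "weakly_convergent_to x 0"
  obtains B where "\<And>n. norm (x n) \<le> B"
proof -
  have "\<exists>B. \<forall>n. norm (x n) \<le> B"
  proof (rule ccontr)
    assume "\<nexists>B. \<forall>n. norm (x n) \<le> B"
    then have "\<forall>k. \<exists>n. real k * 4 ^ k < norm (x n)" by (meson not_le)
    then obtain m where m: "\<And>k. real k * 4 ^ k < norm (x (m k))" by metis
    define y where "y = (\<lambda>k. x (m k))"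
    have "\<exists>h. bounded_linear h \<and> (\<forall>v. \<bar>h v\<bar> \<le> norm v) \<and> h (y k) = norm (y k)" for k
      by (rule norming_functional[of "y k"]) blast
    then obtain h where h: "\<And>k. bounded_linear (h k)" "\<And>k v. \<bar>h k v\<bar> \<le> norm v"
        "\<And>k. h k (y k) = norm (y k)"
      by metis
    \<comment> \<open>If the functional built so far is already at least half of
      \<open>norm (y k) / 4 ^ k\<close> at \<open>y k\<close>, nothing is added; otherwise adding
      \<open>h k / 4 ^ k\<close> makes it so.\<close>
    define c :: "nat \<Rightarrow> ('a \<Rightarrow> real) \<Rightarrow> real" where
      "c = (\<lambda>k \<psi>. if norm (y k) / 4 ^ k / 2 \<le> \<bar>\<psi> (y k)\<bar> then 0 else 1 / 4 ^ k)"
    define \<phi> :: "nat \<Rightarrow> 'a \<Rightarrow> real" where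
      "\<phi> = rec_nat (\<lambda>v. 0) (\<lambda>k \<psi> v. \<psi> v + c k \<psi> * h k v)"
    define g where "g = (\<lambda>k v. c k (\<phi> k) * h k v)"
    have \<phi>: "\<phi> k v = (\<Sum>j<k. g j v)" for k v
      by (induction k) (auto simp: \<phi>_def g_def)
    have g_le: "\<bar>g k v\<bar> \<le> norm v * (1/4) ^ k" for k v
    proof -
      have "\<bar>c k (\<phi> k)\<bar> \<le> (1/4)^k" by (simp add: c_def power_divide)
      then have "\<bar>c k (\<phi> k)\<bar> * \<bar>h k v\<bar> \<le> (1/4)^k * norm v"
        by (intro mult_mono h) auto
      then show ?thesis by (simp add: g_def abs_mult mult.commute)
    qed
    have geo: "(\<Sum>j<n. (1/4::real) ^ j) \<le> 4/3" for n
      by (simp add: sum_gp_strict)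
    have K: "(\<Sum>j<n. \<bar>g j v\<bar>) \<le> norm v * (4/3)" for n v
    proof -
      have "(\<Sum>j<n. \<bar>g j v\<bar>) \<le> (\<Sum>j<n. norm v * (1/4) ^ j)" by (intro sum_mono g_le)
      also have "\<dots> = norm v * (\<Sum>j<n. (1/4) ^ j)" by (simp add: sum_distrib_left)
      also have "\<dots> \<le> norm v * (4/3)" by (intro mult_left_mono geo) simp
      finally show ?thesis .
    qed
    have lin: "linear (g j)" for j
      using h(1)[of j] unfolding g_def
      by (intro bounded_linear.linear bounded_linear_const_mult)
    define F where "F = (\<lambda>v. \<Sum>j. g j v)"
    have F: "bounded_linear F"
      unfolding F_def by (rule bounded_linear_suminf_functionals[OF lin K])
    \<comment> \<open>The constant is \<open>1/2 - 1/3\<close>: the first \<open>Suc k\<close> terms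
      give at least half of \<open>norm (y k) / 4 ^ k\<close>, and the coefficients after index
      \<open>k\<close> sum to at most a third of \<open>1 / 4 ^ k\<close>.\<close>
    have big: "real k / 6 \<le> \<bar>F (y k)\<bar>" for k
    proof -
      have s: "summable (\<lambda>j. \<bar>g j (y k)\<bar>)" by (rule summable_abs_functionals[of g, OF K])
      have "F (y k) = (\<Sum>j. g (j + Suc k) (y k)) + (\<Sum>j<Suc k. g j (y k))"
        unfolding F_def by (rule suminf_split_initial_segment[OF summable_rabs_cancel[OF s]])
      moreover have "\<bar>\<Sum>j. g (j + Suc k) (y k)\<bar> \<le> norm (y k) * (1/4)^k / 3"
      proof -
        have s2: "summable (\<lambda>j. \<bar>g (j + Suc k) (y k)\<bar>)" by (rule summable_ignore_initial_segment[OF s])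
        have "\<bar>\<Sum>j. g (j + Suc k) (y k)\<bar> \<le> (\<Sum>j. \<bar>g (j + Suc k) (y k)\<bar>)"
          by (rule summable_rabs[OF s2])
        also have "\<dots> \<le> norm (y k) * (1/4)^k / 3"
        proof (rule suminf_le_const[OF s2])
          fix n
          have "(\<Sum>j<n. \<bar>g (j + Suc k) (y k)\<bar>) \<le> (\<Sum>j<n. norm (y k) * (1/4) ^ (j + Suc k))"
            by (intro sum_mono g_le)
          also have "\<dots> = norm (y k) * (1/4)^Suc k * (\<Sum>j<n. (1/4) ^ j)"
            by (simp add: sum_distrib_left power_add mult_ac)
          also have "\<dots> \<le> norm (y k) * (1/4)^Suc k * (4/3)"
            by (intro mult_left_mono geo) simp
          finally show "(\<Sum>j<n. \<bar>g (j + Suc k) (y k)\<bar>) \<le> norm (y k) * (1/4)^k / 3" by simp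
        qed
        finally show ?thesis .
      qed
      moreover have "norm (y k) * (1/4)^k / 2 \<le> \<bar>\<Sum>j<Suc k. g j (y k)\<bar>"
      proof -
        have "(\<Sum>j<Suc k. g j (y k)) = \<phi> k (y k) + c k (\<phi> k) * norm (y k)"
          by (simp add: \<phi> g_def h)
        moreover have "norm (y k) * (1/4)^k / 2 \<le> \<bar>\<phi> k (y k) + c k (\<phi> k) * norm (y k)\<bar>"
        proof (cases "norm (y k) / 4 ^ k / 2 \<le> \<bar>\<phi> k (y k)\<bar>")
          case True
          then show ?thesis by (simp add: c_def power_divide)
        next
          case False
          then have "c k (\<phi> k) * norm (y k) = norm (y k) * (1/4)^k"
            by (simp add: c_def power_divide)
          moreover have "\<bar>\<phi> k (y k)\<bar> < norm (y k) * (1/4)^k / 2"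
            using False by (simp add: power_divide)
          ultimately show ?thesis by linarith
        qed
        ultimately show ?thesis by simp
      qed
      ultimately have "norm (y k) * (1/4)^k / 6 \<le> \<bar>F (y k)\<bar>" by linarith
      moreover have "real k \<le> norm (y k) * (1/4)^k"
        using m[of k] by (simp add: y_def power_divide field_simps)
      ultimately show ?thesis by linarith
    qed
    have "(\<lambda>n. F (x n)) \<longlonglongrightarrow> F 0" using x F unfolding weakly_convergent_to_def by blast
    then have "Bseq (\<lambda>n. F (x n))" by (meson convergent_imp_Bseq convergentI)
    then obtain M where M: "\<And>n. norm (F (x n)) \<le> M" unfolding Bseq_def by blast
    obtain k :: nat where "6 * M < real k" using reals_Archimedean2 by blast
    then show False using big[of k] M[of "m k"] by (simp add: y_def)
  qed
  then show ?thesis using that by blast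
qed


section \<open>Disjoint sequences below weakly null sequences\<close>

lemma nonneg_not_tendsto_zero_subseq:
  fixes s :: "nat \<Rightarrow> real"
  assumes "\<And>n. 0 \<le> s n" "\<not> s \<longlonglongrightarrow> 0"
  obtains \<delta> r where "0 < \<delta>" "strict_mono (r :: nat \<Rightarrow> nat)" "\<And>n. \<delta> \<le> s (r n)"
proof -
  obtain \<delta> where \<delta>: "0 < \<delta>" "\<And>N. \<exists>n\<ge>N. \<delta> \<le> s n"
    using assms unfolding LIMSEQ_iff by (auto simp: not_less)
  then have "infinite {n. \<delta> \<le> s n}"
    unfolding infinite_nat_iff_unbounded_le by auto
  then obtain r :: "nat \<Rightarrow> nat" where "strict_mono r" "\<forall>n. r n \<in> {n. \<delta> \<le> s n}"
    using infinite_enumerate by blast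
  then show ?thesis using \<delta>(1) that by auto
qed

lemma weakly_null_subseq:
  assumes "weakly_convergent_to x 0" "strict_mono r"
  shows "weakly_convergent_to (x \<circ> r) 0"
  unfolding weakly_convergent_to_def
proof (intro allI impI)
  fix f :: "'a \<Rightarrow> real" assume "bounded_linear f"
  then have "(\<lambda>n. f (x n)) \<longlonglongrightarrow> f 0" using assms(1) by (simp add: weakly_convergent_to_def)
  from LIMSEQ_subseq_LIMSEQ[OF this assms(2)]
  show "(\<lambda>n. f ((x \<circ> r) n)) \<longlonglongrightarrow> f 0" by (simp add: o_def)
qed

lemma weakly_null_tendsto:
  assumes "weakly_convergent_to x 0" "bounded_linear f"
  shows "(\<lambda>n. f (x n)) \<longlonglongrightarrow> (0::real)"
  using assms linear_0[OF bounded_linear.linear[OF assms(2)]]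
  unfolding weakly_convergent_to_def by metis

lemma weakly_null_uminus:
  assumes "weakly_convergent_to x 0"
  shows "weakly_convergent_to (\<lambda>n. - x n) 0"
  unfolding weakly_convergent_to_def
proof (intro allI impI)
  fix f :: "'a \<Rightarrow> real" assume f: "bounded_linear f"
  have "(\<lambda>n. - f (x n)) \<longlonglongrightarrow> - 0"
    by (intro tendsto_minus weakly_null_tendsto[OF assms f])
  then show "(\<lambda>n. f (- x n)) \<longlonglongrightarrow> f 0"
    using f by (simp add: linear_0 linear_neg bounded_linear.linear)
qed

lemma inf_sum_eq_0:
  fixes v :: "'b \<Rightarrow> 'a::banach_lattice"
  assumes "finite A" "\<And>i. i \<in> A \<Longrightarrow> inf (v i) w = 0" "0 \<le> w"
  shows "inf (sum v A) w = 0"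
  using assms(1,2)
proof (induction A rule: finite_induct)
  case empty
  then show ?case using assms(3) by (simp add: inf_absorb1)
next
  case (insert i A)
  have v: "0 \<le> v j" if "j \<in> insert i A" for j using insert.prems[OF that] by (metis inf_le1)
  have s: "0 \<le> sum v A" using v by (intro sum_nonneg) auto
  have "inf (v i + sum v A) w \<le> inf (v i) w + inf (sum v A) w"
    using v s assms(3) by (intro inf_add_le) auto
  also have "\<dots> = 0" using insert by simp
  finally have "inf (v i + sum v A) w \<le> 0" .
  moreover have "0 \<le> inf (v i + sum v A) w" using v s assms(3) by simp
  ultimately show ?case using insert.hyps by (simp add: order.antisym)
qed

text \<open>Disjoint bands merge into a single band, whose functional is still below
  \<open>f\<close>. The bound is uniform in \<open>n\<close>, so series of such functionals
  converge.\<close>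

lemma sum_band_functional_le:
  fixes v :: "nat \<Rightarrow> 'a::banach_lattice"
  assumes f: "positive_functional f" and v: "\<And>i. 0 \<le> v i"
    and d: "\<And>i j. i \<noteq> j \<Longrightarrow> inf (v i) (v j) = 0" and y: "0 \<le> y"
  shows "(\<Sum>j<n. band_functional f (v j) y) \<le> f y"
proof -
  have "(\<Sum>j<n. band_functional f (v j) y) \<le> band_functional f (\<Sum>j<n. v j) y" for n :: nat
  proof (induction n)
    case 0
    show ?case using band_functional_nonneg[OF f _ y, of 0] by simp
  next
    case (Suc n)
    have "inf (\<Sum>j<n. v j) (v n) = 0"
      by (intro inf_sum_eq_0 d v) auto
    from band_functional_add_disjoint[OF f this y] Suc show ?case by simp
  qed
  also have "band_functional f (\<Sum>j<n. v j) y \<le> f y"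
    by (intro band_functional_le f y sum_nonneg v)
  finally show ?thesis .
qed

text \<open>A gliding hump: were \<open>f (v n)\<close> bounded away from 0, then the sum of the functionals carried by
  suitable \<open>v n\<close> would not tend to 0 along \<open>x\<close>.\<close>

lemma disjoint_below_weakly_null:
  fixes x v :: "nat \<Rightarrow> 'a::banach_lattice"
  assumes x: "weakly_convergent_to x 0" and v0: "\<And>n. 0 \<le> v n" and vx: "\<And>n. v n \<le> pprt (x n)"
    and d: "\<And>i j. i \<noteq> j \<Longrightarrow> inf (v i) (v j) = 0"
  shows "weakly_convergent_to v 0"
proof (rule weakly_null_positiveI, rule ccontr)
  fix f :: "'a \<Rightarrow> real"
  assume f: "positive_functional f" and not: "\<not> (\<lambda>n. f (v n)) \<longlonglongrightarrow> 0"
  obtain \<delta> r where \<delta>: "0 < \<delta>" and r: "strict_mono (r :: nat \<Rightarrow> nat)" and big: "\<And>n. \<delta> \<le> f (v (r n))"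
    using nonneg_not_tendsto_zero_subseq[OF _ not] f v0 by (auto simp: positive_functional_def)
  define z where "z = x \<circ> r"
  define g where "g = (\<lambda>n. band_functional f (v (r n)))"
  have z: "weakly_convergent_to z 0" unfolding z_def by (rule weakly_null_subseq[OF x r])
  have gpos: "positive_functional (g n)" for n
    unfolding g_def by (intro positive_band_functional f v0)
  have gbl: "bounded_linear (g n)" for n using gpos by (simp add: positive_functional_def)
  have glin: "linear (g n)" for n using gbl by (rule bounded_linear.linear)
  \<comment> \<open>Being below \<open>pprt (z n)\<close>, the element \<open>v (r n)\<close> is
    disjoint from \<open>pprt (- z n)\<close>, so \<open>g n\<close> does not see the negative
    part.\<close>
  have hump: "\<delta> \<le> g n (z n)" for n
  proof -
    have "inf (v (r n)) (pprt (- z n)) = 0"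
      using vx[of "r n"] v0 by (intro disjoint_mono[OF inf_pprt_pprt_uminus[of "z n"]]) (auto simp: z_def)
    then have "g n (pprt (- z n)) = 0" unfolding g_def by (rule band_functional_disjoint[OF f])
    moreover have "f (v (r n)) \<le> g n (pprt (z n))"
      unfolding g_def using v0 vx[of "r n"] by (intro band_functional_upper[OF f, of _ _ 1]) (auto simp: z_def)
    moreover have "g n (z n) = g n (pprt (z n)) - g n (pprt (- z n))"
      using linear_diff[OF glin] by (metis pprt_minus_pprt_uminus)
    ultimately show ?thesis using big[of n] by simp
  qed
  obtain C where C: "\<And>y. norm (f y) \<le> norm y * C"
    using f unfolding positive_functional_def using bounded_linear.bounded by blast
  have K: "(\<Sum>j<n. \<bar>g j y\<bar>) \<le> norm y * C" for n y
  proof -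
    have "(\<Sum>j<n. \<bar>g j y\<bar>) \<le> (\<Sum>j<n. g j \<bar>y\<bar>)"
      by (intro sum_mono positive_functional_abs_le gpos)
    also have "\<dots> \<le> f \<bar>y\<bar>"
      unfolding g_def using r
      by (intro sum_band_functional_le f v0 d) (auto simp: strict_mono_eq)
    also have "\<dots> \<le> norm \<bar>y\<bar> * C" using C[of "\<bar>y\<bar>"] by simp
    also have "norm \<bar>y\<bar> = norm y" by (rule norm_abs)
    finally show ?thesis .
  qed
  \<comment> \<open>Beyond \<open>h k\<close> two things are small: the functionals up to
    \<open>k\<close> on later terms, by weak nullity, and the tail of functionals on
    \<open>z k\<close>, by summability.\<close>
  have "\<exists>h>k. (\<forall>n\<ge>h. (\<Sum>m\<le>k. \<bar>g m (z n)\<bar>) \<le> \<delta>/4) \<and> (\<forall>n. (\<Sum>m=h..<n. \<bar>g m (z k)\<bar>) \<le> \<delta>/4)" for k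
  proof -
    have "(\<lambda>n. \<Sum>m\<le>k. \<bar>g m (z n)\<bar>) \<longlonglongrightarrow> (\<Sum>m\<le>k. \<bar>0\<bar>)"
      by (intro tendsto_sum tendsto_rabs weakly_null_tendsto[OF z gbl])
    then have "eventually (\<lambda>n. (\<Sum>m\<le>k. \<bar>g m (z n)\<bar>) < \<delta>/4) sequentially"
      using \<delta> by (intro order_tendstoD(2)) auto
    then obtain h1 where h1: "\<And>n. n \<ge> h1 \<Longrightarrow> (\<Sum>m\<le>k. \<bar>g m (z n)\<bar>) < \<delta>/4"
      unfolding eventually_sequentially by blast
    have "summable (\<lambda>m. \<bar>g m (z k)\<bar>)" by (rule summable_abs_functionals[of g, OF K])
    then obtain h2 where h2: "\<And>m n. m \<ge> h2 \<Longrightarrow> (\<Sum>i=m..<n. \<bar>g i (z k)\<bar>) < \<delta>/4"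
      unfolding summable_Cauchy using \<delta>
      by (metis (no_types, lifting) abs_ge_self divide_pos_pos order_le_less_trans real_norm_def zero_less_numeral)
    show ?thesis
    proof (intro exI[of _ "Max {h1, h2, Suc k}"] conjI allI impI)
      fix n
      show "(\<Sum>m = Max {h1, h2, Suc k}..<n. \<bar>g m (z k)\<bar>) \<le> \<delta> / 4"
        by (rule less_imp_le, rule h2) simp
    qed (use h1 in \<open>auto intro!: less_imp_le\<close>)
  qed
  then obtain h where h: "\<And>k. k < h k" "\<And>k n. h k \<le> n \<Longrightarrow> (\<Sum>m\<le>k. \<bar>g m (z n)\<bar>) \<le> \<delta>/4"
      "\<And>k n. (\<Sum>m=h k..<n. \<bar>g m (z k)\<bar>) \<le> \<delta>/4"
    by metis
  define k where "k = (\<lambda>j. (h ^^ j) 0)"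
  have k_Suc: "k (Suc j) = h (k j)" for j by (simp add: k_def)
  have k: "strict_mono k" by (rule strict_mono_Suc_iff[THEN iffD2]) (simp add: k_Suc h)
  \<comment> \<open>Unchosen indices are switched off without renumbering, so the summability bound
    for \<open>g\<close> passes to \<open>G\<close>.\<close>
  define G where "G = (\<lambda>m y. if m \<in> range k then g m y else 0)"
  have G_le: "\<bar>G m y\<bar> \<le> \<bar>g m y\<bar>" for m y by (simp add: G_def)
  have KG: "(\<Sum>j<n. \<bar>G j y\<bar>) \<le> norm y * C" for n y
    using sum_mono[of "{..<n}" "\<lambda>j. \<bar>G j y\<bar>" "\<lambda>j. \<bar>g j y\<bar>"] G_le K[of y n] by force
  have Glin: "linear (G m)" for m
  proof (cases "m \<in> range k")
    case True
    then show ?thesis using glin by (simp add: G_def)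
  next
    case False
    then show ?thesis by (simp add: G_def linear_iff)
  qed
  define F where "F = (\<lambda>y. \<Sum>j. G j y)"
  have F: "bounded_linear F" unfolding F_def by (rule bounded_linear_suminf_functionals[OF Glin KG])
  have F_ge: "\<delta>/2 \<le> F (z (k j))" for j
  proof -
    let ?K = "k j"
    let ?G = "\<lambda>m. G m (z ?K)"
    have "summable ?G" by (rule summable_rabs_cancel[OF summable_abs_functionals[of G, OF KG]])
    then have lim: "(\<lambda>n. \<Sum>m<n. ?G m) \<longlonglongrightarrow> F (z ?K)" unfolding F_def by (rule summable_LIMSEQ)
    \<comment> \<open>The hump at \<open>?K\<close> is at least \<open>\<delta>\<close>. Chosen
      functionals before and after it cost \<open>\<delta>/4\<close> each, and none is active
      strictly between \<open>?K\<close> and \<open>h ?K = k (Suc j)\<close>.\<close>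
    have "\<delta>/2 \<le> (\<Sum>m<n. ?G m)" if n: "h ?K \<le> n" for n
    proof -
      have "(\<Sum>m<n. ?G m) = (\<Sum>m<?K. ?G m) + (\<Sum>m=?K..<h ?K. ?G m) + (\<Sum>m=h ?K..<n. ?G m)"
        using n h(1)[of ?K] by (simp add: lessThan_atLeast0 sum.atLeastLessThan_concat)
      also have "(\<Sum>m=?K..<h ?K. ?G m) = ?G ?K + (\<Sum>m=Suc ?K..<h ?K. ?G m)"
        by (rule sum.atLeast_Suc_lessThan[OF h(1)])
      finally have "(\<Sum>m<n. ?G m) = (\<Sum>m<?K. ?G m) + (?G ?K + (\<Sum>m=Suc ?K..<h ?K. ?G m)) + (\<Sum>m=h ?K..<n. ?G m)" .
      moreover have "?G ?K = g ?K (z ?K)" by (simp add: G_def)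
      moreover have "(\<Sum>m=Suc ?K..<h ?K. ?G m) = 0"
      proof (rule sum.neutral, rule ballI)
        fix m assume m: "m \<in> {Suc ?K..<h ?K}"
        have "m \<noteq> k i" for i
          using m strict_mono_less[OF k, of j i] strict_mono_less[OF k, of i "Suc j"] k_Suc[of j] by auto
        then show "?G m = 0" by (auto simp: G_def)
      qed
      moreover have "\<bar>\<Sum>m=h ?K..<n. ?G m\<bar> \<le> \<delta>/4"
      proof -
        have "\<bar>\<Sum>m=h ?K..<n. ?G m\<bar> \<le> (\<Sum>m=h ?K..<n. \<bar>g m (z ?K)\<bar>)"
          by (rule order_trans[OF sum_abs sum_mono]) (rule G_le)
        then show ?thesis using h(3)[of ?K n] by simp
      qed
      moreover have "\<bar>\<Sum>m<?K. ?G m\<bar> \<le> \<delta>/4"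
      proof (cases j)
        case 0
        then show ?thesis using \<delta> by (simp add: k_def)
      next
        case (Suc i)
        \<comment> \<open>Every chosen index below \<open>?K = h (k i)\<close> is at most
          \<open>k i\<close>, the range that \<open>h (k i)\<close> was made to control.\<close>
        have "(\<Sum>m<?K. ?G m) = (\<Sum>m\<le>k i. ?G m)"
        proof (rule sum.mono_neutral_right)
          show "\<forall>m\<in>{..<?K} - {..k i}. ?G m = 0"
          proof
            fix m assume m: "m \<in> {..<?K} - {..k i}"
            have "m \<noteq> k l" for l
              using m strict_mono_less[OF k, of i l] strict_mono_less[OF k, of l j] Suc by auto
            then show "?G m = 0" by (auto simp: G_def)
          qed
        qed (use k_Suc[of i] h(1)[of "k i"] Suc in auto)
        also have "\<bar>\<dots>\<bar> \<le> (\<Sum>m\<le>k i. \<bar>g m (z ?K)\<bar>)"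
          by (rule order_trans[OF sum_abs sum_mono]) (rule G_le)
        also have "\<dots> \<le> \<delta>/4" using Suc k_Suc[of i] by (intro h(2)) simp
        finally show ?thesis .
      qed
      ultimately show ?thesis using hump[of ?K] by linarith
    qed
    then show ?thesis by (intro LIMSEQ_le_const[OF lim]) blast
  qed
  have "(\<lambda>j. F ((z \<circ> k) j)) \<longlonglongrightarrow> 0"
    by (rule weakly_null_tendsto[OF weakly_null_subseq[OF z k] F])
  then have "eventually (\<lambda>j. F ((z \<circ> k) j) < \<delta>/2) sequentially"
    using \<delta> by (intro order_tendstoD(2)) auto
  then obtain j where "F ((z \<circ> k) j) < \<delta>/2" unfolding eventually_sequentially by blast
  then show False using F_ge[of j] by simp
qed

section \<open>Almost order boundedness of weakly null sequences\<close>

lemma le_suminf_nonneg: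
  fixes s :: "nat \<Rightarrow> 'a::banach_lattice"
  assumes "summable s" "\<And>n. 0 \<le> s n"
  shows "s i \<le> suminf s"
proof (rule limit_le)
  show "(\<lambda>n. s i) \<longlonglongrightarrow> s i" by simp
  show "(\<lambda>n. \<Sum>j<n + Suc i. s j) \<longlonglongrightarrow> suminf s"
    by (rule LIMSEQ_ignore_initial_segment[OF summable_LIMSEQ[OF assms(1)]])
  show "s i \<le> (\<Sum>j<n + Suc i. s j)" for n
    using sum_mono2[of "{..<n + Suc i}" "{i}" s] assms(2) by simp
qed

text \<open>Otherwise some terms stick out by more than \<open>e\<close> over large multiples of all
  earlier ones. Subtracting \<open>4 ^ k\<close> times the earlier terms and a small multiple of the
  weighted sum \<open>w\<close> turns them into a disjoint sequence below the positive parts of a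
  subsequence. It is weakly null, yet its norms do not tend to 0.\<close>

lemma schur_weakly_null_almost_order_bounded:
  fixes x :: "nat \<Rightarrow> 'a::banach_lattice"
  assumes schur: "positive_schur_property TYPE('a)" and x: "weakly_convergent_to x 0" and e: "0 < e"
  shows "\<exists>u\<ge>0. \<forall>n. norm (pprt (pprt (x n) - u)) \<le> e"
proof (rule ccontr)
  assume "\<not> ?thesis"
  then have large: "\<exists>n. e < norm (pprt (pprt (x n) - u))" if "0 \<le> u" for u
    using that by (meson not_le)
  define p where "p = (\<lambda>n. pprt (x n))"
  have p0: "0 \<le> p n" for n by (simp add: p_def)
  \<comment> \<open>\<open>N\<close> is both the index to be passed and the exponent of the factor.
    The new index exceeds \<open>N\<close> because a term with index at most \<open>N\<close> is
    absorbed by the subtracted sum.\<close>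
  have "\<exists>n>N. e < norm (pprt (p n - 4 ^ N *\<^sub>R (\<Sum>i\<le>N. p i)))" for N :: nat
  proof -
    have u0: "0 \<le> 4 ^ N *\<^sub>R (\<Sum>i\<le>N. p i)"
      by (intro scaleR_nonneg_nonneg sum_nonneg p0) simp
    then obtain n where n: "e < norm (pprt (p n - 4 ^ N *\<^sub>R (\<Sum>i\<le>N. p i)))"
      using large unfolding p_def by blast
    have "N < n"
    proof (rule ccontr)
      assume "\<not> N < n"
      then have "p n \<le> (\<Sum>i\<le>N. p i)" using sum_mono2[of "{..N}" "{n}" p] p0 by simp
      also have "\<dots> = 1 *\<^sub>R (\<Sum>i\<le>N. p i)" by simp
      also have "\<dots> \<le> 4 ^ N *\<^sub>R (\<Sum>i\<le>N. p i)"
        by (intro scaleR_right_mono sum_nonneg p0) simp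
      finally have "pprt (p n - 4 ^ N *\<^sub>R (\<Sum>i\<le>N. p i)) = 0" by simp
      then show False using n e by simp
    qed
    with n show ?thesis by blast
  qed
  then obtain h where h: "\<And>N. N < h N"
      "\<And>N. e < norm (pprt (p (h N) - 4 ^ N *\<^sub>R (\<Sum>i\<le>N. p i)))"
    by metis
  \<comment> \<open>Starting at 1 gives \<open>Suc k \<le> r k\<close>, so the factor
    \<open>4 ^ r m\<close> guaranteed by \<open>h\<close> dominates the \<open>4 ^ Suc m\<close>
    used in \<open>v (Suc m)\<close>.\<close>
  define r where "r = (\<lambda>k. (h ^^ k) 1)"
  have r_Suc: "r (Suc k) = h (r k)" for k by (simp add: r_def)
  have r: "strict_mono r" by (rule strict_mono_Suc_iff[THEN iffD2]) (simp add: r_Suc h)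
  have r_ge: "Suc k \<le> r k" for k
  proof (induction k)
    case (Suc k)
    then show ?case using h(1)[of "r k"] by (simp add: r_Suc)
  qed (simp add: r_def)
  define q where "q = (\<lambda>k. p (r k))"
  have q0: "0 \<le> q k" for k by (simp add: q_def p0)
  obtain B where B: "\<And>n. norm (x n) \<le> B" using weakly_null_bounded[OF x] by blast
  have "summable (\<lambda>i. (1/2) ^ i *\<^sub>R q i)"
  proof (rule summable_comparison_test')
    show "summable (\<lambda>i. B * (1/2) ^ i)" by (intro summable_mult summable_geometric) simp
    show "norm ((1/2) ^ i *\<^sub>R q i) \<le> B * (1/2) ^ i" for i
      using norm_pprt_le[of "x (r i)"] B[of "r i"] by (simp add: q_def p_def field_simps)
  qed
  moreover define w where "w = (\<Sum>i. (1/2) ^ i *\<^sub>R q i)"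
  ultimately have w: "(1/2) ^ i *\<^sub>R q i \<le> w" for i
    unfolding w_def by (intro le_suminf_nonneg scaleR_nonneg_nonneg q0) auto
  have w0: "0 \<le> w" using w[of 0] q0[of 0] by simp
  define v where "v = (\<lambda>k. pprt (q k - 4 ^ k *\<^sub>R (\<Sum>i<k. q i) - (1/2) ^ k *\<^sub>R w))"
  have v0: "0 \<le> v k" for k by (simp add: v_def)
  have disj: "inf (v j) (v k) = 0" if jk: "j < k" for j k
  proof -
    \<comment> \<open>This \<open>?z\<close> separates the two: \<open>v k\<close> lies below its
      negative part because \<open>q j\<close> is among the terms subtracted there, and
      \<open>v j\<close> lies below a multiple of its positive part because \<open>w\<close>
      dominates \<open>(1/2) ^ k q k\<close> and \<open>j < k\<close>.\<close>
    let ?z = "4 ^ k *\<^sub>R q j - q k"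
    have "q j \<le> (\<Sum>i<k. q i)" using sum_mono2[of "{..<k}" "{j}" q] q0 jk by simp
    then have "4 ^ k *\<^sub>R q j \<le> 4 ^ k *\<^sub>R (\<Sum>i<k. q i)" by (intro scaleR_left_mono) auto
    moreover have "0 \<le> (1/2) ^ k *\<^sub>R w" using w0 by (intro scaleR_nonneg_nonneg) auto
    ultimately have "4 ^ k *\<^sub>R q j + 0 \<le> 4 ^ k *\<^sub>R (\<Sum>i<k. q i) + (1/2) ^ k *\<^sub>R w"
      by (rule add_mono)
    then have vk: "v k \<le> pprt (- ?z)"
      unfolding v_def by (intro pprt_mono) (simp add: algebra_simps)
    have "(1/4) ^ k *\<^sub>R q k \<le> (1/2) ^ (j + k) *\<^sub>R q k"
    proof (intro scaleR_right_mono q0)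
      have "(1/4::real) ^ k = (1/2) ^ (k + k)" by (simp add: power_add flip: power_mult_distrib)
      also have "\<dots> \<le> (1/2) ^ (j + k)" using jk by (intro power_decreasing) auto
      finally show "(1/4::real) ^ k \<le> (1/2) ^ (j + k)" .
    qed
    also have "\<dots> = (1/2) ^ j *\<^sub>R ((1/2) ^ k *\<^sub>R q k)" by (simp add: power_add)
    also have "\<dots> \<le> (1/2) ^ j *\<^sub>R w" by (intro scaleR_left_mono w) simp
    finally have wk: "(1/4) ^ k *\<^sub>R q k \<le> (1/2) ^ j *\<^sub>R w" .
    have s0: "0 \<le> 4 ^ j *\<^sub>R (\<Sum>i<j. q i)" by (intro scaleR_nonneg_nonneg sum_nonneg q0) simp
    have eq: "(1/4) ^ k *\<^sub>R ?z = q j - (1/4) ^ k *\<^sub>R q k"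
      by (simp add: scaleR_diff_right flip: power_mult_distrib)
    have "v j \<le> pprt ((1/4) ^ k *\<^sub>R ?z)"
      unfolding v_def eq using s0 wk by (intro pprt_mono diff_mono) simp_all
    also have "\<dots> = (1/4) ^ k *\<^sub>R pprt ?z" by (rule pprt_scaleR) simp
    finally have vj: "v j \<le> (1/4) ^ k *\<^sub>R pprt ?z" .
    have "inf ((1/4) ^ k *\<^sub>R pprt ?z) (pprt (- ?z)) = 0"
      by (rule inf_scaleR_eq_0[OF inf_pprt_pprt_uminus]) simp
    then show ?thesis by (rule disjoint_mono[OF _ v0 v0 vj vk])
  qed
  have "weakly_convergent_to v 0"
  proof (rule disjoint_below_weakly_null[OF weakly_null_subseq[OF x r] v0])
    fix k
    have "0 \<le> 4 ^ k *\<^sub>R (\<Sum>i<k. q i)" by (intro scaleR_nonneg_nonneg sum_nonneg q0) simp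
    moreover have "0 \<le> (1/2) ^ k *\<^sub>R w" using w0 by (intro scaleR_nonneg_nonneg) auto
    ultimately have "q k - 4 ^ k *\<^sub>R (\<Sum>i<k. q i) - (1/2) ^ k *\<^sub>R w \<le> q k"
      by (simp add: algebra_simps)
    then show "v k \<le> pprt ((x \<circ> r) k)"
      unfolding v_def using q0[of k] by (intro pprt_leI) (simp_all add: q_def p_def)
  next
    fix i j :: nat assume "i \<noteq> j"
    then show "inf (v i) (v j) = 0" using disj[of i j] disj[of j i] by (metis inf_commute nat_neq_iff)
  qed
  then have "(\<lambda>k. norm (v k)) \<longlonglongrightarrow> 0"
    using schur v0 by (simp add: positive_schur_property_def)
  moreover have "(\<lambda>k. (1/2) ^ k * norm w) \<longlonglongrightarrow> 0 * norm w"
    by (intro tendsto_mult_right LIMSEQ_power_zero) simp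
  ultimately have "(\<lambda>k. norm (v k) + (1/2) ^ k * norm w) \<longlonglongrightarrow> 0 + 0 * norm w"
    by (rule tendsto_add)
  then have "eventually (\<lambda>k. norm (v k) + (1/2) ^ k * norm w < e) sequentially"
    using e by (intro order_tendstoD(2)) auto
  then have "eventually (\<lambda>k. norm (v (Suc k)) + (1/2) ^ Suc k * norm w < e) sequentially"
    using eventually_sequentially_Suc[of "\<lambda>k. norm (v k) + (1/2) ^ k * norm w < e"] by blast
  then obtain m where m: "norm (v (Suc m)) + (1/2) ^ Suc m * norm w < e"
    unfolding eventually_sequentially by blast
  have "(\<Sum>i<Suc m. q i) \<le> (\<Sum>i\<le>r m. p i)"
  proof -
    have "(\<Sum>i<Suc m. q i) = sum p (r ` {..<Suc m})"
      using strict_mono_imp_inj_on[OF r] unfolding q_def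
      by (subst sum.reindex) (auto intro: inj_on_subset simp: o_def)
    also have "\<dots> \<le> (\<Sum>i\<le>r m. p i)"
      using strict_mono_mono[OF r] by (intro sum_mono2 p0) (auto simp: less_Suc_eq_le mono_def)
    finally show ?thesis .
  qed
  then have "4 ^ Suc m *\<^sub>R (\<Sum>i<Suc m. q i) \<le> 4 ^ r m *\<^sub>R (\<Sum>i\<le>r m. p i)"
    using r_ge[of m] by (intro scaleR_mono power_increasing sum_nonneg q0) auto
  then have "pprt (p (h (r m)) - 4 ^ r m *\<^sub>R (\<Sum>i\<le>r m. p i)) \<le> pprt (q (Suc m) - 4 ^ Suc m *\<^sub>R (\<Sum>i<Suc m. q i))"
    unfolding q_def r_Suc by (intro pprt_mono diff_mono) auto
  also have "\<dots> \<le> v (Suc m) + (1/2) ^ Suc m *\<^sub>R w"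
  proof (rule pprt_leI)
    show "q (Suc m) - 4 ^ Suc m *\<^sub>R (\<Sum>i<Suc m. q i) \<le> v (Suc m) + (1/2) ^ Suc m *\<^sub>R w"
      using pprt_ge_self[of "q (Suc m) - 4 ^ Suc m *\<^sub>R (\<Sum>i<Suc m. q i) - (1/2) ^ Suc m *\<^sub>R w"]
      unfolding v_def diff_le_eq .
  qed (intro add_nonneg_nonneg v0 scaleR_nonneg_nonneg w0, simp)
  finally have "norm (pprt (p (h (r m)) - 4 ^ r m *\<^sub>R (\<Sum>i\<le>r m. p i)))
      \<le> norm (v (Suc m) + (1/2) ^ Suc m *\<^sub>R w)"
    by (intro norm_mono_nonneg) auto
  also have "\<dots> \<le> norm (v (Suc m)) + norm ((1/2) ^ Suc m *\<^sub>R w)" by (rule norm_triangle_ineq)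
  finally show False using m h(2)[of "r m"] by simp
qed


text \<open>Majorants for the errors \<open>1 / (m + 1)\<close> are put into one convergent series
  \<open>W\<close>, and each of them is below a multiple of \<open>W\<close>. The accuracy
  \<open>e\<close> then only affects the multiple.\<close>

lemma schur_weakly_null_dominated:
  fixes x :: "nat \<Rightarrow> 'a::banach_lattice"
  assumes schur: "positive_schur_property TYPE('a)" and x: "weakly_convergent_to x 0"
  obtains W where "0 \<le> W"
    "\<And>e. 0 < e \<Longrightarrow> \<exists>R::nat. \<forall>n. norm (pprt (\<bar>x n\<bar> - real R *\<^sub>R W)) \<le> e"
proof -
  have "\<exists>u\<ge>0. \<forall>n. norm (pprt (\<bar>x n\<bar> - u)) \<le> 1 / real (Suc m)" for m
  proof -
    have e: "0 < 1 / real (Suc m) / 2" by simp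
    obtain u1 where u1: "0 \<le> u1" "\<And>n. norm (pprt (pprt (x n) - u1)) \<le> 1 / real (Suc m) / 2"
      using schur_weakly_null_almost_order_bounded[OF schur x e] by blast
    obtain u2 where u2: "0 \<le> u2" "\<And>n. norm (pprt (pprt (- x n) - u2)) \<le> 1 / real (Suc m) / 2"
      using schur_weakly_null_almost_order_bounded[OF schur weakly_null_uminus[OF x] e] by blast
    have "norm (pprt (\<bar>x n\<bar> - (u1 + u2))) \<le> 1 / real (Suc m)" for n
    proof -
      have "\<bar>x n\<bar> - (u1 + u2) = (pprt (x n) - u1) + (pprt (- x n) - u2)"
        by (simp add: algebra_simps flip: pprt_plus_pprt_uminus)
      then have "norm (pprt (\<bar>x n\<bar> - (u1 + u2))) \<le> norm (pprt (pprt (x n) - u1) + pprt (pprt (- x n) - u2))"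
        by (metis norm_mono_nonneg pprt_add_le zero_le_pprt)
      also have "\<dots> \<le> norm (pprt (pprt (x n) - u1)) + norm (pprt (pprt (- x n) - u2))"
        by (rule norm_triangle_ineq)
      also have "\<dots> \<le> 1 / real (Suc m) / 2 + 1 / real (Suc m) / 2" by (intro add_mono u1 u2)
      also have "\<dots> = 1 / real (Suc m)" by (rule field_sum_of_halves)
      finally show ?thesis .
    qed
    then show ?thesis using u1(1) u2(1) by (intro exI[of _ "u1 + u2"]) simp
  qed
  then obtain u where u: "\<And>m. 0 \<le> u m" "\<And>m n. norm (pprt (\<bar>x n\<bar> - u m)) \<le> 1 / real (Suc m)"
    by metis
  define a where "a = (\<lambda>m. (1/2) ^ m / (1 + norm (u m)))"
  have a: "0 < a m" for m unfolding a_def by (intro divide_pos_pos add_pos_nonneg) auto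
  have au: "a m * norm (u m) \<le> (1/2) ^ m" for m
  proof -
    have "norm (u m) / (1 + norm (u m)) \<le> 1" by (simp add: divide_le_eq_1 add_pos_nonneg)
    then have "(1/2) ^ m * (norm (u m) / (1 + norm (u m))) \<le> (1/2) ^ m * 1" by (intro mult_left_mono) auto
    then show ?thesis by (simp add: a_def)
  qed
  have "summable (\<lambda>m. a m *\<^sub>R u m)"
  proof (rule summable_comparison_test')
    show "summable (\<lambda>m. (1/2::real) ^ m)" by (intro summable_geometric) simp
    show "norm (a m *\<^sub>R u m) \<le> (1/2) ^ m" for m using au[of m] a[of m] by simp
  qed
  moreover define W where "W = (\<Sum>m. a m *\<^sub>R u m)"
  ultimately have uW: "a m *\<^sub>R u m \<le> W" for m
    unfolding W_def using a u by (intro le_suminf_nonneg scaleR_nonneg_nonneg) (auto intro: less_imp_le)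
  have W: "0 \<le> W"
    using uW[of 0] scaleR_nonneg_nonneg[OF less_imp_le[OF a[of 0]] u(1)[of 0]] by (rule order_trans[rotated])
  moreover have "\<exists>R::nat. \<forall>n. norm (pprt (\<bar>x n\<bar> - real R *\<^sub>R W)) \<le> e" if "0 < e" for e
  proof -
    obtain m where m: "1 / real (Suc m) < e" using \<open>0 < e\<close> nat_approx_posE by blast
    obtain R :: nat where R: "1 / a m \<le> real R" using real_arch_simple by blast
    have "(1 / a m) *\<^sub>R (a m *\<^sub>R u m) \<le> (1 / a m) *\<^sub>R W"
      using a[of m] by (intro scaleR_left_mono uW) auto
    also have "\<dots> \<le> real R *\<^sub>R W" by (intro scaleR_right_mono R W)
    finally have "u m \<le> real R *\<^sub>R W" using a[of m] by simp
    then have "norm (pprt (\<bar>x n\<bar> - real R *\<^sub>R W)) \<le> norm (pprt (\<bar>x n\<bar> - u m))" for n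
      by (intro norm_mono_nonneg pprt_mono diff_left_mono) auto
    then show ?thesis using u(2)[of _ m] m by (meson order_trans less_imp_le)
  qed
  ultimately show ?thesis by (rule that)
qed

section \<open>Functionals detecting the norm on an order interval\<close>

text \<open>The increments between chosen indices telescope under a positive functional, so their
  values are summable. Hence they are weakly null, and then norm null, which contradicts their
  choice.\<close>

lemma schur_increasing_convergent:
  fixes s :: "nat \<Rightarrow> 'a::banach_lattice"
  assumes schur: "positive_schur_property TYPE('a)"
    and inc: "\<And>n. s n \<le> s (Suc n)" and bd: "\<And>n. s n \<le> W"
  shows "convergent s"
proof -
  have mono: "s m \<le> s n" if "m \<le> n" for m n using lift_Suc_mono_le[of s, OF inc that] .
  have "Cauchy s"
  proof (rule ccontr)
    assume "\<not> Cauchy s"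
    then obtain e where e: "0 < e" and "\<And>N. \<exists>n\<ge>N. e \<le> norm (s n - s N)"
      unfolding Cauchy_altdef2 by (auto simp: dist_norm not_less)
    then obtain h where h: "\<And>N. N \<le> h N" "\<And>N. e \<le> norm (s (h N) - s N)" by metis
    define k where "k = (\<lambda>j. (h ^^ j) 0)"
    define t where "t = (\<lambda>j. s (k (Suc j)) - s (k j))"
    have t0: "0 \<le> t j" for j using h(1)[of "k j"] mono by (simp add: t_def k_def)
    have "weakly_convergent_to t 0"
    proof (rule weakly_null_positiveI)
      fix f :: "'a \<Rightarrow> real" assume f: "positive_functional f"
      have fd: "f (y - z) = f y - f z" for y z
        using f by (simp add: positive_functional_def linear_diff bounded_linear.linear)
      have "summable (\<lambda>j. f (t j))"
      proof (rule summableI_nonneg_bounded)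
        show "0 \<le> f (t j)" for j using f t0 by (simp add: positive_functional_def)
        fix n
        have "(\<Sum>j<n. f (t j)) = f (s (k n)) - f (s (k 0))"
          unfolding t_def fd by (rule sum_lessThan_telescope)
        also have "\<dots> \<le> f W - f (s (k 0))"
          by (intro diff_right_mono positive_functional_mono[OF f] bd)
        finally show "(\<Sum>j<n. f (t j)) \<le> f W - f (s (k 0))" .
      qed
      then show "(\<lambda>j. f (t j)) \<longlonglongrightarrow> 0" by (rule summable_LIMSEQ_zero)
    qed
    then have "(\<lambda>j. norm (t j)) \<longlonglongrightarrow> 0" using schur t0 by (simp add: positive_schur_property_def)
    moreover have "e \<le> norm (t j)" for j using h(2)[of "k j"] by (simp add: t_def k_def)
    ultimately have "e \<le> 0" by (meson LIMSEQ_le_const)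
    then show False using e by simp
  qed
  then show ?thesis by (simp add: Cauchy_convergent)
qed

lemma positive_functional_add:
  "positive_functional f \<Longrightarrow> positive_functional g \<Longrightarrow> positive_functional (\<lambda>x. f x + g x)"
  by (simp add: positive_functional_def bounded_linear_add)

lemma positive_functional_zero: "positive_functional (\<lambda>x. 0)"
  by (simp add: positive_functional_def)

text \<open>If no positive functional is good enough, choose \<open>z j\<close> small on the norming functionals of
  all earlier terms. The tail sums of \<open>z\<close>, truncated at \<open>W\<close>, then form a decreasing sequence that is
  not Cauchy.\<close>

lemma schur_interval_functional_step:
  fixes W :: "'a::banach_lattice"
  assumes schur: "positive_schur_property TYPE('a)" and e: "0 < e" and W: "0 \<le> W"
  shows "\<exists>f. positive_functional f \<and> (\<exists>\<delta>>0. \<forall>z. 0 \<le> z \<longrightarrow> z \<le> W \<longrightarrow> f z < \<delta> \<longrightarrow> norm z < e)"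
proof (rule ccontr)
  assume "\<not> ?thesis"
  then have "\<exists>z. 0 \<le> z \<and> z \<le> W \<and> f z < \<delta> \<and> e \<le> norm z" if "positive_functional f" "0 < \<delta>" for f \<delta>
    using that by (meson not_le)
  \<comment> \<open>The bounds \<open>e/4 * (1/2) ^ j\<close> add up to at most \<open>e/2\<close>,
    half of the lower bound for the norms.\<close>
  then have "\<forall>f j. \<exists>z. positive_functional f \<longrightarrow> 0 \<le> z \<and> z \<le> W \<and> f z < e/4 * (1/2) ^ j \<and> e \<le> norm z"
    using e by (metis divide_pos_pos mult_pos_pos zero_less_power zero_less_numeral zero_less_one)
  then obtain Z where Z: "\<And>f j. positive_functional f \<Longrightarrow>
      0 \<le> Z f j \<and> Z f j \<le> W \<and> f (Z f j) < e/4 * (1/2::real) ^ (j::nat) \<and> e \<le> norm (Z f j)"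
    by metis
  have "\<forall>z::'a. \<exists>f. 0 \<le> z \<longrightarrow> positive_functional f \<and> (\<forall>x. \<bar>f x\<bar> \<le> norm x) \<and> f z = norm z"
    by (metis positive_norming_functional)
  then obtain F where F: "\<And>z::'a. 0 \<le> z \<Longrightarrow>
      positive_functional (F z) \<and> (\<forall>x. \<bar>F z x\<bar> \<le> norm x) \<and> F z z = norm z"
    by metis
  \<comment> \<open>\<open>\<Phi> j\<close> is the sum of the norming functionals of
    \<open>z 0\<close>, ..., \<open>z (j - 1)\<close>. All are positive, so smallness of
    \<open>\<Phi> j\<close> at \<open>z j\<close> bounds each of them there.\<close>
  define \<Phi> :: "nat \<Rightarrow> 'a \<Rightarrow> real" where
    "\<Phi> = rec_nat (\<lambda>x. 0) (\<lambda>j \<psi> x. \<psi> x + F (Z \<psi> j) x)"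
  define z where "z = (\<lambda>j. Z (\<Phi> j) j)"
  define f where "f = (\<lambda>j. F (z j))"
  have \<Phi>_Suc: "\<Phi> (Suc j) = (\<lambda>x. \<Phi> j x + f j x)" for j by (simp add: \<Phi>_def f_def z_def)
  have \<Phi>pos: "positive_functional (\<Phi> j)" for j
  proof (induction j)
    case 0
    show ?case by (simp add: \<Phi>_def positive_functional_zero)
  next
    case (Suc j)
    then show ?case unfolding \<Phi>_Suc f_def z_def using Z[OF Suc] F by (intro positive_functional_add) auto
  qed
  have z: "0 \<le> z j" "z j \<le> W" "\<Phi> j (z j) < e/4 * (1/2) ^ j" "e \<le> norm (z j)" for j
    using Z[OF \<Phi>pos, of j j] by (auto simp: z_def)
  have f: "positive_functional (f j)" "\<bar>f j y\<bar> \<le> norm y" "f j (z j) = norm (z j)" for j y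
    using F[OF z(1)] by (auto simp: f_def)
  have \<Phi>: "\<Phi> j y = (\<Sum>i<j. f i y)" for j y
    by (induction j) (simp_all add: \<Phi>_Suc, simp add: \<Phi>_def)
  have cross: "f i (z j) \<le> e/4 * (1/2) ^ j" if "i < j" for i j
  proof -
    have "f i (z j) \<le> \<Phi> j (z j)"
      unfolding \<Phi> using that z(1) f(1) by (intro member_le_sum) (auto simp: positive_functional_def)
    then show ?thesis using z(3)[of j] by simp
  qed
  \<comment> \<open>Truncation at \<open>W\<close> makes the partial sums order bounded, hence
    convergent, and still leaves them above \<open>z j\<close> since
    \<open>z j \<le> W\<close>.\<close>
  define T where "T = (\<lambda>j n. inf W (\<Sum>i=j..<j+n. z i))"
  have "T j n \<le> T j (Suc n)" for j n
    unfolding T_def by (intro inf_mono order_refl sum_mono2 z) auto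
  moreover have "T j n \<le> W" for j n by (simp add: T_def)
  ultimately have "convergent (T j)" for j by (intro schur_increasing_convergent[OF schur])
  then obtain S where S: "\<And>j. T j \<longlonglongrightarrow> S j" unfolding convergent_def by metis
  have S_dec: "S (Suc j) \<le> S j" for j
  proof (rule limit_le[OF S LIMSEQ_Suc[OF S]])
    fix n
    have "(\<Sum>i=Suc j..<Suc j + n. z i) \<le> (\<Sum>i=j..<j + Suc n. z i)"
      by (intro sum_mono2 z) auto
    then show "T (Suc j) n \<le> T j (Suc n)" unfolding T_def by (intro inf_mono) auto
  qed
  have S_ge: "z j \<le> S j" for j
  proof (rule limit_le[OF tendsto_const LIMSEQ_Suc[OF S]])
    fix n
    have "z j \<le> (\<Sum>i=j..<j + Suc n. z i)"
      using sum_mono2[of "{j..<j + Suc n}" "{j}" z] z(1) by simp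
    then show "z j \<le> T j (Suc n)" using z(2)[of j] by (simp add: T_def)
  qed
  have S_nonneg: "0 \<le> S j" for j using S_ge[of j] z(1)[of j] by (rule order_trans[rotated])
  have small: "f j (S (Suc j)) \<le> e/2" for j
  proof (rule LIMSEQ_le_const2)
    have bl: "bounded_linear (f j)" using f(1) by (simp add: positive_functional_def)
    then show "(\<lambda>n. f j (T (Suc j) n)) \<longlonglongrightarrow> f j (S (Suc j))"
      by (rule bounded_linear.tendsto[OF _ S])
    have "f j (T (Suc j) n) \<le> e/2" for n
    proof -
      have "f j (T (Suc j) n) \<le> f j (\<Sum>i=Suc j..<Suc j+n. z i)"
        by (intro positive_functional_mono[OF f(1)]) (simp add: T_def)
      also have "\<dots> = (\<Sum>i=Suc j..<Suc j+n. f j (z i))"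
        by (rule linear_sum[OF bounded_linear.linear[OF bl]])
      also have "\<dots> \<le> (\<Sum>i=Suc j..<Suc j+n. e/4 * (1/2) ^ i)" by (intro sum_mono cross) auto
      also have "\<dots> \<le> (\<Sum>i<Suc j+n. e/4 * (1/2) ^ i)" using e by (intro sum_mono2) auto
      also have "\<dots> = e/4 * (\<Sum>i<Suc j+n. (1/2) ^ i)" by (rule sum_distrib_left[symmetric])
      also have "(\<Sum>i<Suc j+n. (1/2::real) ^ i) \<le> 2" by (simp add: sum_gp_strict)
      finally show ?thesis using e by simp
    qed
    then show "\<exists>N. \<forall>n\<ge>N. f j (T (Suc j) n) \<le> e/2" by blast
  qed
  \<comment> \<open>The functional \<open>f j\<close> has norm at most 1, is at least
    \<open>e\<close> on \<open>S j\<close> because of \<open>z j\<close>, and is at most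
    \<open>e/2\<close> on \<open>S (Suc j)\<close>.\<close>
  have gap: "e/2 \<le> norm (S j - S (Suc j))" for j
  proof -
    have "f j (S j - S (Suc j)) = f j (S j) - f j (S (Suc j))"
      using f(1)[of j] by (simp add: positive_functional_def linear_diff bounded_linear.linear)
    moreover have "f j (z j) \<le> f j (S j)" by (rule positive_functional_mono[OF f(1) S_ge])
    ultimately show ?thesis using small[of j] f(3)[of j] z(4)[of j] f(2)[of j "S j - S (Suc j)"] by linarith
  qed
  have "convergent (\<lambda>j. - S j)"
    by (rule schur_increasing_convergent[OF schur, where W = 0]) (use S_dec S_nonneg in auto)
  then obtain l where l: "(\<lambda>j. - S j) \<longlonglongrightarrow> l" unfolding convergent_def by blast
  have "(\<lambda>j. norm (- S (Suc j) - - S j)) \<longlonglongrightarrow> norm (l - l)"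
    by (intro tendsto_norm tendsto_diff LIMSEQ_Suc[OF l] l)
  then have "e/2 \<le> norm (l - l)"
    using gap by (intro LIMSEQ_le_const) (auto simp: algebra_simps)
  then show False using e by simp
qed

text \<open>The functionals for the accuracies \<open>1 / (m + 1)\<close> are weighted and summed.
  By positivity the sum dominates each weighted summand, so its smallness on a positive element
  activates every threshold \<open>\<delta> m\<close>.\<close>

lemma schur_interval_functional:
  fixes W :: "'a::banach_lattice"
  assumes schur: "positive_schur_property TYPE('a)" and W: "0 \<le> W"
  obtains \<phi> where "positive_functional \<phi>"
    "\<And>z. (\<And>n. 0 \<le> z n) \<Longrightarrow> (\<And>n. z n \<le> W) \<Longrightarrow> (\<lambda>n. \<phi> (z n)) \<longlonglongrightarrow> 0 \<Longrightarrow> z \<longlonglongrightarrow> 0"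
proof -
  have "\<forall>m. \<exists>f. positive_functional f \<and>
      (\<exists>\<delta>>0. \<forall>z. 0 \<le> z \<longrightarrow> z \<le> W \<longrightarrow> f z < \<delta> \<longrightarrow> norm z < 1 / real (Suc m))"
    by (intro allI schur_interval_functional_step[OF schur _ W]) simp
  then obtain f \<delta> where f: "\<And>m. positive_functional (f m)" and \<delta>: "\<And>m. 0 < \<delta> m"
      "\<And>m z. 0 \<le> z \<Longrightarrow> z \<le> W \<Longrightarrow> f m z < \<delta> m \<Longrightarrow> norm z < 1 / real (Suc m)"
    by metis
  have "\<exists>K\<ge>0. \<forall>x. \<bar>f m x\<bar> \<le> norm x * K" for m
  proof -
    have "bounded_linear (f m)" using f by (simp add: positive_functional_def)
    from bounded_linear.nonneg_bounded[OF this] show ?thesis by auto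
  qed
  then obtain K where K: "\<And>m. 0 \<le> K m" "\<And>m x. \<bar>f m x\<bar> \<le> norm x * K m" by metis
  define c where "c = (\<lambda>m. (1/2) ^ m / (1 + K m))"
  have c: "0 < c m" for m unfolding c_def using K(1)[of m] by (intro divide_pos_pos) auto
  define g where "g = (\<lambda>m x. c m * f m x)"
  have g_le: "\<bar>g m x\<bar> \<le> norm x * (1/2) ^ m" for m x
  proof -
    have "\<bar>g m x\<bar> \<le> c m * (norm x * K m)"
      using c[of m] K(2)[of m x] by (simp add: g_def abs_mult)
    also have "\<dots> = norm x * (1/2) ^ m * (K m / (1 + K m))" by (simp add: c_def)
    also have "\<dots> \<le> norm x * (1/2) ^ m * 1"
      using K(1)[of m] by (intro mult_left_mono) (auto simp: field_simps)
    finally show ?thesis by simp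
  qed
  have gK: "(\<Sum>j<n. \<bar>g j x\<bar>) \<le> norm x * 2" for n x
  proof -
    have "(\<Sum>j<n. \<bar>g j x\<bar>) \<le> (\<Sum>j<n. norm x * (1/2) ^ j)" by (intro sum_mono g_le)
    also have "\<dots> = norm x * (\<Sum>j<n. (1/2) ^ j)" by (simp add: sum_distrib_left)
    also have "\<dots> \<le> norm x * 2" by (intro mult_left_mono) (simp_all add: sum_gp_strict)
    finally show ?thesis .
  qed
  have glin: "linear (g j)" for j
    using f[of j] unfolding g_def positive_functional_def
    by (intro bounded_linear.linear bounded_linear_const_mult) simp
  define \<phi> where "\<phi> = (\<lambda>x. \<Sum>j. g j x)"
  have sum: "summable (\<lambda>j. g j x)" for x
    by (rule summable_rabs_cancel[OF summable_abs_functionals[of g, OF gK]])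
  have g0: "0 \<le> g j x" if "0 \<le> x" for j x
    using f[of j] c[of j] that by (simp add: g_def positive_functional_def)
  have "positive_functional \<phi>"
    unfolding positive_functional_def \<phi>_def
    using bounded_linear_suminf_functionals[OF glin gK] sum g0 by (auto intro: suminf_nonneg)
  moreover have "z \<longlonglongrightarrow> 0"
    if z: "\<And>n. 0 \<le> z n" "\<And>n. z n \<le> W" and lim: "(\<lambda>n. \<phi> (z n)) \<longlonglongrightarrow> 0" for z
  proof (rule LIMSEQ_I)
    fix e :: real assume "0 < e"
    then obtain m where m: "1 / real (Suc m) < e" using nat_approx_posE by blast
    have "eventually (\<lambda>n. \<phi> (z n) < c m * \<delta> m) sequentially"
      using lim c[of m] \<delta>(1)[of m] by (intro order_tendstoD(2)) auto
    moreover have "norm (z n) < 1 / real (Suc m)" if "\<phi> (z n) < c m * \<delta> m" for n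
    proof (rule \<delta>(2)[OF z])
      have "g m (z n) \<le> \<phi> (z n)"
        unfolding \<phi>_def using sum_le_suminf[OF sum, of "{m}" "z n"] g0[OF z(1)] by simp
      then have "c m * f m (z n) < c m * \<delta> m" using that by (simp add: g_def)
      then show "f m (z n) < \<delta> m" using c[of m] by simp
    qed
    ultimately show "\<exists>N. \<forall>n\<ge>N. norm (z n - 0) < e"
      using m unfolding eventually_sequentially by (metis diff_zero less_trans)
  qed
  ultimately show ?thesis by (rule that)
qed


section \<open>Selecting the subsequence\<close>

lemma truncation:
  fixes x u :: "'a::banach_lattice"
  assumes u: "0 \<le> u"
  obtains y where "\<bar>y\<bar> \<le> u" "\<bar>x - y\<bar> \<le> pprt (\<bar>x\<bar> - u)"
proof -
  \<comment> \<open>Positive and negative part are cut at \<open>u\<close> separately. Both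
    \<open>?y\<close> and \<open>x - ?y\<close> are then differences of positive elements with a
    common upper bound, which bounds their moduli without a factor 2.\<close>
  let ?y = "inf (pprt x) u - inf (pprt (- x)) u"
  let ?a = "pprt (pprt x - u)" and ?b = "pprt (pprt (- x) - u)"
  have abs_diff: "\<bar>a - b\<bar> \<le> c" if "0 \<le> a" "0 \<le> b" "a \<le> c" "b \<le> c" for a b c :: 'a
    using that by (intro abs_leI) (auto simp: algebra_simps add_increasing add_increasing2)
  have "\<bar>?y\<bar> \<le> u" using u by (intro abs_diff) auto
  moreover have "x - ?y = (pprt x - inf (pprt x) u) - (pprt (- x) - inf (pprt (- x)) u)"
    by (subst (1) pprt_minus_pprt_uminus[of x, symmetric]) (simp only: algebra_simps)
  then have eq: "x - ?y = ?a - ?b" by (simp only: diff_inf_eq_pprt)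
  have "\<bar>?a - ?b\<bar> \<le> pprt (\<bar>x\<bar> - u)"
    by (intro abs_diff pprt_mono diff_right_mono zero_le_pprt)
      (simp_all flip: pprt_plus_pprt_uminus)
  with eq have "\<bar>x - ?y\<bar> \<le> pprt (\<bar>x\<bar> - u)" by simp
  ultimately show ?thesis by (rule that)
qed

text \<open>As \<open>\<bar>y\<bar> \<le> u\<close>, the set \<open>{a + y > 0}\<close> lies between
  \<open>{a - u > 0}\<close> and \<open>{a + u > 0}\<close>. Integrating \<open>a + y\<close> over
  it, the positive part of \<open>y\<close> is estimated on the larger set and the negative part on
  the smaller one, neither of which depends on \<open>y\<close>.\<close>

lemma pprt_increment_le:
  fixes a y u :: "'a::banach_lattice"
  assumes f: "positive_functional f" and y: "\<bar>y\<bar> \<le> u"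
  shows "f (pprt (a + y)) \<le> f (pprt a) + band_functional f (pprt (a + u)) (pprt y)
    - band_functional f (pprt (a - u)) (pprt (- y))"
proof -
  let ?G = "band_functional f (pprt (a + y))"
  have G: "positive_functional ?G" by (rule positive_band_functional[OF f zero_le_pprt])
  then have lin: "linear ?G" by (simp add: positive_functional_def bounded_linear.linear)
  have "y \<le> u" "- y \<le> u" using abs_ge_self[of y] abs_ge_minus_self[of y] y by (auto intro: order_trans)
  then have yu: "a + y \<le> a + u" "a - u \<le> a + y" by (simp_all add: minus_le_iff)
  have "f (pprt (a + y)) = ?G (a + (pprt y - pprt (- y)))"
    using band_functional_pprt_self[OF f, of "a + y"] by (simp add: pprt_minus_pprt_uminus)
  also have "\<dots> = ?G a + ?G (pprt y) - ?G (pprt (- y))"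
    by (simp add: linear_add[OF lin] linear_diff[OF lin])
  also have "\<dots> \<le> f (pprt a) + band_functional f (pprt (a + u)) (pprt y)
      - band_functional f (pprt (a - u)) (pprt (- y))"
  proof (intro diff_mono add_mono)
    have "?G a \<le> ?G (pprt a)" by (rule positive_functional_mono[OF G pprt_ge_self])
    also have "\<dots> \<le> f (pprt a)" by (intro band_functional_le f zero_le_pprt)
    finally show "?G a \<le> f (pprt a)" .
  qed (intro band_functional_mono f zero_le_pprt pprt_mono yu)+
  finally show ?thesis .
qed

text \<open>The sum over \<open>m\<close> of \<open>pprt (s - m u)\<close> is a lattice substitute for the square of \<open>s\<close>. Its
  first order variation is linear in \<open>x\<close>, and the error term telescopes to \<open>f u\<close>, independently
  of the number of levels.\<close>

lemma potential_step:
  fixes s x u :: "'a::banach_lattice"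
  assumes f: "positive_functional f" and u: "0 \<le> u"
  defines "B \<equiv> \<lambda>m. band_functional f (pprt (s - real m *\<^sub>R u))"
  shows "(\<Sum>m<L. f (pprt (s + x - real (Suc m) *\<^sub>R u))) \<le>
    (\<Sum>m<L. f (pprt (s - real (Suc m) *\<^sub>R u))) + (\<Sum>m<L. B (Suc m) x)
      + 2 * real L * f (pprt (\<bar>x\<bar> - u)) + f u"
proof -
  obtain y where y: "\<bar>y\<bar> \<le> u" "\<bar>x - y\<bar> \<le> pprt (\<bar>x\<bar> - u)" using truncation[OF u] by blast
  let ?\<eta> = "f (pprt (\<bar>x\<bar> - u))"
  let ?p = "pprt y" and ?n = "pprt (- y)"
  have fadd: "f (a + b) = f a + f b" for a b
    using f by (simp add: positive_functional_def linear_add bounded_linear.linear)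
  have B: "positive_functional (B m)" for m
    unfolding B_def by (rule positive_band_functional[OF f zero_le_pprt])
  have Blin: "linear (B m)" for m
    using B[of m] by (simp add: positive_functional_def bounded_linear.linear)
  have B_le: "B m a \<le> f a" if "0 \<le> a" for m a
    unfolding B_def by (rule band_functional_le[OF f zero_le_pprt that])
  have B0: "0 \<le> B m a" if "0 \<le> a" for m a
    using B[of m] that by (simp add: positive_functional_def)
  \<comment> \<open>Moving by \<open>u\<close> is moving by one level, so the two bracketing bands
    are those of the neighbouring levels \<open>m\<close> and \<open>Suc (Suc m)\<close>.\<close>
  have step: "f (pprt (s + x - real (Suc m) *\<^sub>R u)) \<le> f (pprt (s - real (Suc m) *\<^sub>R u)) + (B m ?p - B (Suc (Suc m)) ?n) + ?\<eta>" for m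
  proof -
    let ?a = "s - real (Suc m) *\<^sub>R u"
    have "s + x - real (Suc m) *\<^sub>R u = (?a + y) + (x - y)" by (simp add: algebra_simps)
    then have "f (pprt (s + x - real (Suc m) *\<^sub>R u)) \<le> f (pprt (?a + y) + pprt (x - y))"
      by (metis positive_functional_mono[OF f] pprt_add_le)
    also have "\<dots> = f (pprt (?a + y)) + f (pprt (x - y))" by (rule fadd)
    also have "f (pprt (x - y)) \<le> ?\<eta>"
      by (intro positive_functional_mono[OF f] order_trans[OF pprt_le_abs y(2)])
    also have "f (pprt (?a + y)) \<le> f (pprt ?a) + band_functional f (pprt (?a + u)) ?p
        - band_functional f (pprt (?a - u)) ?n"
      by (rule pprt_increment_le[OF f y(1)])
    also have "?a + u = s - real m *\<^sub>R u" by (simp add: algebra_simps)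
    also have "?a - u = s - real (Suc (Suc m)) *\<^sub>R u" by (simp add: algebra_simps scaleR_2)
    finally show ?thesis unfolding B_def by simp
  qed
  have "(\<Sum>m<L. f (pprt (s + x - real (Suc m) *\<^sub>R u))) \<le>
      (\<Sum>m<L. f (pprt (s - real (Suc m) *\<^sub>R u)) + (B m ?p - B (Suc (Suc m)) ?n) + ?\<eta>)"
    by (intro sum_mono step)
  also have "\<dots> = (\<Sum>m<L. f (pprt (s - real (Suc m) *\<^sub>R u)))
      + ((\<Sum>m<L. B m ?p) - (\<Sum>m<L. B (Suc (Suc m)) ?n)) + real L * ?\<eta>"
    by (simp add: sum.distrib sum_subtractf)
  \<comment> \<open>Shifting both sums to level \<open>Suc m\<close> leaves only boundary terms. The
    positive ones are at most \<open>f ?p + f ?n = f \<bar>y\<bar> \<le> f u\<close>, with no factor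
    \<open>L\<close>.\<close>
  also have "(\<Sum>m<L. B m ?p) - (\<Sum>m<L. B (Suc (Suc m)) ?n) \<le> (\<Sum>m<L. B (Suc m) y) + f u"
  proof -
    have "(\<Sum>m<L. B (Suc m) ?p - B m ?p) = B L ?p - B 0 ?p"
      by (rule sum_lessThan_telescope)
    then have 1: "(\<Sum>m<L. B m ?p) = (\<Sum>m<L. B (Suc m) ?p) + B 0 ?p - B L ?p"
      by (simp add: sum_subtractf)
    have "(\<Sum>m<L. B (Suc (Suc m)) ?n - B (Suc m) ?n) = B (Suc L) ?n - B (Suc 0) ?n"
      by (rule sum_lessThan_telescope[of "\<lambda>m. B (Suc m) ?n"])
    then have 2: "(\<Sum>m<L. B (Suc (Suc m)) ?n) = (\<Sum>m<L. B (Suc m) ?n) + B (Suc L) ?n - B (Suc 0) ?n"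
      by (simp add: sum_subtractf)
    have 3: "(\<Sum>m<L. B (Suc m) y) = (\<Sum>m<L. B (Suc m) ?p) - (\<Sum>m<L. B (Suc m) ?n)"
      unfolding sum_subtractf[symmetric]
      by (intro sum.cong refl) (metis linear_diff[OF Blin] pprt_minus_pprt_uminus)
    have "f ?p + f ?n \<le> f u"
      unfolding fadd[symmetric] pprt_plus_pprt_uminus by (rule positive_functional_mono[OF f y(1)])
    then show ?thesis
      unfolding 1 2 3
      using B_le[of ?p 0] B0[of ?p L] B0[of ?n "Suc L"] B_le[of ?n "Suc 0"] by simp
  qed
  \<comment> \<open>Going back from the truncated \<open>y\<close> to \<open>x\<close> costs
    \<open>?\<eta>\<close> once more per level, whence the factor 2 in the statement.\<close>
  also have "(\<Sum>m<L. B (Suc m) y) \<le> (\<Sum>m<L. B (Suc m) x + ?\<eta>)"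
  proof (intro sum_mono)
    fix m
    have "B (Suc m) y = B (Suc m) x - B (Suc m) (x - y)" by (simp add: linear_diff[OF Blin])
    moreover have "- B (Suc m) (x - y) \<le> B (Suc m) \<bar>x - y\<bar>"
      using positive_functional_abs_le[OF B, of "Suc m" "x - y"] by simp
    moreover have "B (Suc m) \<bar>x - y\<bar> \<le> f \<bar>x - y\<bar>" by (rule B_le) simp
    moreover have "f \<bar>x - y\<bar> \<le> ?\<eta>" by (rule positive_functional_mono[OF f y(2)])
    ultimately show "B (Suc m) y \<le> B (Suc m) x + ?\<eta>" by simp
  qed
  also have "\<dots> = (\<Sum>m<L. B (Suc m) x) + real L * ?\<eta>" by (simp add: sum.distrib)
  finally show ?thesis by (simp add: algebra_simps)
qed

text \<open>With \<open>L\<close> so large that \<open>f u \<le> L * \<eta>\<close>, one step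
  eventually raises the potential by at most \<open>4 * L * \<eta>\<close>. Comparing it with
  \<open>L * f (pprt (S n))\<close> and dividing by \<open>L\<close> gives linear growth of slope
  \<open>4 * \<eta>\<close>.\<close>

lemma sublinear_growth_pprt:
  fixes y :: "nat \<Rightarrow> 'a::banach_lattice"
  defines "S \<equiv> \<lambda>n. \<Sum>k<n. y k"
  assumes f: "positive_functional f" and W: "0 \<le> W"
    and sel: "\<And>n l. l \<le> n \<Longrightarrow> band_functional f (pprt (S n - real l *\<^sub>R W)) (y n) \<le> 1 / real (Suc n)"
    and dom: "\<And>\<eta>. 0 < \<eta> \<Longrightarrow> \<exists>R::nat. \<forall>n. f (pprt (\<bar>y n\<bar> - real R *\<^sub>R W)) \<le> \<eta>"
  shows "(\<lambda>n. f (pprt (S n)) / real n) \<longlonglongrightarrow> 0"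
proof (rule LIMSEQ_I)
  fix e :: real assume e: "0 < e"
  \<comment> \<open>The final bound is \<open>5 * \<eta>\<close>: slope \<open>4 * \<eta>\<close>
    and one more \<open>\<eta>\<close> to absorb the constant \<open>C\<close>.\<close>
  define \<eta> where "\<eta> = e/8"
  have \<eta>: "0 < \<eta>" using e by (simp add: \<eta>_def)
  obtain R :: nat where R: "\<And>n. f (pprt (\<bar>y n\<bar> - real R *\<^sub>R W)) \<le> \<eta>" using dom[OF \<eta>] by blast
  define u where "u = real R *\<^sub>R W"
  have u: "0 \<le> u" unfolding u_def using W by (intro scaleR_nonneg_nonneg) auto
  have fu: "0 \<le> f u" using f u by (simp add: positive_functional_def)
  have flin: "linear f" using f by (simp add: positive_functional_def bounded_linear.linear)
  obtain L' :: nat where L': "f u / \<eta> \<le> real L'" using real_arch_simple by blast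
  define L where "L = Suc L'"
  have L: "f u \<le> real L * \<eta>" "0 < real L"
  proof -
    have "f u \<le> real L' * \<eta>" using L' \<eta> by (simp add: pos_divide_le_eq)
    also have "\<dots> \<le> real L * \<eta>" using \<eta> by (intro mult_right_mono) (auto simp: L_def)
    finally show "f u \<le> real L * \<eta>" .
  qed (simp add: L_def)
  define \<Psi> where "\<Psi> = (\<lambda>n. \<Sum>m<L. f (pprt (S n - real (Suc m) *\<^sub>R u)))"
  obtain N1 :: nat where N1: "1 / \<eta> \<le> real N1" using real_arch_simple by blast
  \<comment> \<open>From \<open>L * R\<close> on, each level \<open>(m + 1) u = (m + 1) R W\<close>
    with \<open>m < L\<close> is covered by the selection; from \<open>N1\<close> on,
    \<open>1 / (n + 1) \<le> \<eta>\<close>.\<close>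
  define N where "N = max (L * R) N1"
  \<comment> \<open>The four units of \<open>L * \<eta>\<close> are one from the selection, two from
    the truncation and one from \<open>f u\<close>.\<close>
  have step: "\<Psi> (Suc n) \<le> \<Psi> n + 4 * real L * \<eta>" if n: "N \<le> n" for n
  proof -
    have "\<Psi> (Suc n) \<le> \<Psi> n + (\<Sum>m<L. band_functional f (pprt (S n - real (Suc m) *\<^sub>R u)) (y n))
        + 2 * real L * f (pprt (\<bar>y n\<bar> - u)) + f u"
      unfolding \<Psi>_def using potential_step[OF f u, where s = "S n" and x = "y n" and L = L]
      by (simp add: S_def)
    moreover have "(\<Sum>m<L. band_functional f (pprt (S n - real (Suc m) *\<^sub>R u)) (y n)) \<le> (\<Sum>m<L. \<eta>)"
    proof (intro sum_mono)
      fix m assume "m \<in> {..<L}"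
      then have "Suc m * R \<le> L * R" by (intro mult_le_mono) auto
      also have "\<dots> \<le> n" using n by (simp add: N_def)
      finally have "band_functional f (pprt (S n - real (Suc m * R) *\<^sub>R W)) (y n) \<le> 1 / real (Suc n)"
        by (rule sel)
      also have "1 / real (Suc n) \<le> \<eta>"
      proof -
        have "1 / \<eta> \<le> real (Suc n)" using N1 n by (simp add: N_def)
        then show ?thesis using \<eta> by (simp add: field_simps)
      qed
      finally show "band_functional f (pprt (S n - real (Suc m) *\<^sub>R u)) (y n) \<le> \<eta>"
        by (simp only: u_def scaleR_scaleR of_nat_mult)
    qed
    moreover have "2 * real L * f (pprt (\<bar>y n\<bar> - u)) \<le> 2 * real L * \<eta>"
      using R[of n] unfolding u_def by (intro mult_left_mono) auto
    ultimately show ?thesis using L(1) by simp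
  qed
  have \<Psi>: "\<Psi> (N + n) \<le> \<Psi> N + 4 * real L * \<eta> * real n" for n
  proof (induction n)
    case (Suc n)
    then show ?case using step[of "N + n"] by (simp add: algebra_simps)
  qed simp
  have \<Psi>_ge: "real L * f (pprt (S n)) \<le> \<Psi> n + real L * (real L * f u)" for n
  proof -
    have "f (pprt (S n)) \<le> f (pprt (S n - real (Suc m) *\<^sub>R u)) + real L * f u" if "m < L" for m
    proof -
      have "S n \<le> pprt (S n - real (Suc m) *\<^sub>R u) + real (Suc m) *\<^sub>R u"
        using pprt_ge_self[of "S n - real (Suc m) *\<^sub>R u"] by (simp only: diff_le_eq)
      then have "pprt (S n) \<le> pprt (S n - real (Suc m) *\<^sub>R u) + real (Suc m) *\<^sub>R u"
        using u by (intro pprt_leI add_nonneg_nonneg scaleR_nonneg_nonneg) auto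
      then have "f (pprt (S n)) \<le> f (pprt (S n - real (Suc m) *\<^sub>R u) + real (Suc m) *\<^sub>R u)"
        by (rule positive_functional_mono[OF f])
      also have "\<dots> = f (pprt (S n - real (Suc m) *\<^sub>R u)) + real (Suc m) * f u"
        by (simp only: linear_add[OF flin] linear_scale[OF flin] real_scaleR_def)
      also have "real (Suc m) * f u \<le> real L * f u" using that fu by (intro mult_right_mono) auto
      finally show ?thesis by simp
    qed
    then have "(\<Sum>m<L. f (pprt (S n))) \<le> (\<Sum>m<L. f (pprt (S n - real (Suc m) *\<^sub>R u)) + real L * f u)"
      by (intro sum_mono) auto
    then show ?thesis by (simp add: \<Psi>_def sum.distrib)
  qed
  define C where "C = \<Psi> N / real L + real L * f u"
  have bound: "f (pprt (S n)) \<le> C + 4 * \<eta> * real n" if "N \<le> n" for n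
  proof -
    have "\<Psi> n \<le> \<Psi> N + 4 * real L * \<eta> * real (n - N)" using \<Psi>[of "n - N"] that by simp
    also have "\<dots> \<le> \<Psi> N + 4 * real L * \<eta> * real n"
      using \<eta> by (intro add_left_mono mult_left_mono) auto
    finally have "real L * f (pprt (S n)) \<le> \<Psi> N + 4 * real L * \<eta> * real n + real L * (real L * f u)"
      using \<Psi>_ge[of n] by simp
    also have "\<dots> = real L * (C + 4 * \<eta> * real n)" using L(2) by (simp add: C_def field_simps)
    finally show ?thesis using L(2) by simp
  qed
  obtain M :: nat where M: "C / \<eta> \<le> real M" using real_arch_simple by blast
  show "\<exists>N. \<forall>n\<ge>N. norm (f (pprt (S n)) / real n - 0) < e"
  proof (intro exI[of _ "max N (Suc M)"] allI impI)
    fix n assume n: "max N (Suc M) \<le> n"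
    have "C \<le> real M * \<eta>" using M \<eta> by (simp add: pos_divide_le_eq)
    also have "\<dots> \<le> real n * \<eta>" using n \<eta> by (intro mult_right_mono) auto
    finally have "f (pprt (S n)) \<le> 5 * \<eta> * real n" using bound[of n] n by (simp add: algebra_simps)
    then have "f (pprt (S n)) / real n \<le> 5 * \<eta>" using n by (simp add: pos_divide_le_eq)
    moreover have "0 \<le> f (pprt (S n))" using f by (simp add: positive_functional_def)
    moreover have "5 * \<eta> < e" using e by (simp add: \<eta>_def)
    ultimately show "norm (f (pprt (S n)) / real n - 0) < e" by simp
  qed
qed

text \<open>The partial sum so far determines finitely many functionals, one per level
  \<open>l \<le> n\<close> and sign, and a weakly null sequence is eventually small on all of them.
  Both signs are treated at once so that one subsequence controls \<open>S n\<close> and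
  \<open>- S n\<close>.\<close>

lemma select_subsequence:
  fixes x :: "nat \<Rightarrow> 'a::banach_lattice" and f :: "'a \<Rightarrow> real"
  assumes x: "weakly_convergent_to x 0" and f: "positive_functional f"
  obtains r where "strict_mono r"
    "\<And>n l. l \<le> n \<Longrightarrow>
      \<bar>band_functional f (pprt ((\<Sum>k<n. x (r k)) - real l *\<^sub>R W)) (x (r n))\<bar> \<le> 1 / real (Suc n)"
    "\<And>n l. l \<le> n \<Longrightarrow>
      \<bar>band_functional f (pprt (- (\<Sum>k<n. x (r k)) - real l *\<^sub>R W)) (x (r n))\<bar> \<le> 1 / real (Suc n)"
proof -
  let ?B = "\<lambda>s l. band_functional f (pprt (s - real l *\<^sub>R W))"
  have "\<exists>j\<ge>i. \<forall>l\<le>n. \<bar>?B s l (x j)\<bar> \<le> 1 / real (Suc n) \<and> \<bar>?B (- s) l (x j)\<bar> \<le> 1 / real (Suc n)"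
    for n i :: nat and s
  proof -
    have ev: "eventually (\<lambda>j. \<bar>?B t l (x j)\<bar> \<le> 1 / real (Suc n)) sequentially" for t l
    proof -
      have "(\<lambda>j. \<bar>?B t l (x j)\<bar>) \<longlonglongrightarrow> \<bar>0\<bar>"
        using positive_band_functional[OF f zero_le_pprt, of "t - real l *\<^sub>R W"]
        by (intro tendsto_rabs weakly_null_tendsto[OF x]) (simp add: positive_functional_def)
      then have "eventually (\<lambda>j. \<bar>?B t l (x j)\<bar> < 1 / real (Suc n)) sequentially"
        by (rule order_tendstoD(2)) simp
      then show ?thesis by (rule eventually_mono) simp
    qed
    have "eventually (\<lambda>j. \<forall>l\<in>{..n}. \<bar>?B s l (x j)\<bar> \<le> 1 / real (Suc n) \<and> \<bar>?B (- s) l (x j)\<bar> \<le> 1 / real (Suc n)) sequentially"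
      by (intro eventually_ball_finite ballI eventually_conj ev) simp
    from eventually_happens[OF eventually_conj[OF eventually_ge_at_top[of i] this]]
    show ?thesis by auto
  qed
  then have "\<forall>n i s. \<exists>j\<ge>i. \<forall>l\<le>n. \<bar>?B s l (x j)\<bar> \<le> 1 / real (Suc n) \<and> \<bar>?B (- s) l (x j)\<bar> \<le> 1 / real (Suc n)"
    by blast
  then obtain P where P: "\<And>n i s. i \<le> P n i s" "\<And>n i s l. l \<le> n \<Longrightarrow>
      \<bar>?B s l (x (P n i s))\<bar> \<le> 1 / real (Suc n) \<and> \<bar>?B (- s) l (x (P n i s))\<bar> \<le> 1 / real (Suc n)"
    by metis
  \<comment> \<open>The state holds the partial sum chosen so far and the least index still
    allowed.\<close>
  define st where
    "st = rec_nat (0, 0) (\<lambda>n p. (fst p + x (P n (snd p) (fst p)), Suc (P n (snd p) (fst p))))"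
  define r where "r = (\<lambda>n. P n (snd (st n)) (fst (st n)))"
  have st_Suc: "st (Suc n) = (fst (st n) + x (r n), Suc (r n))" for n by (simp add: st_def r_def)
  have st_0: "st 0 = (0, 0)" by (simp add: st_def)
  have S: "fst (st n) = (\<Sum>k<n. x (r k))" for n by (induction n) (simp_all add: st_Suc st_0)
  have "strict_mono r"
  proof (rule strict_mono_Suc_iff[THEN iffD2], rule allI)
    fix n
    show "r n < r (Suc n)" using P(1)[of "Suc (r n)" "Suc n" "fst (st (Suc n))"]
      by (subst (2) r_def) (simp add: st_Suc)
  qed
  moreover have "\<bar>?B (\<Sum>k<n. x (r k)) l (x (r n))\<bar> \<le> 1 / real (Suc n)"
      "\<bar>?B (- (\<Sum>k<n. x (r k))) l (x (r n))\<bar> \<le> 1 / real (Suc n)" if "l \<le> n" for n l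
    using P(2)[OF that, of "fst (st n)" "snd (st n)"] unfolding S[symmetric] by (simp_all add: r_def)
  ultimately show ?thesis by (rule that)
qed

section \<open>Norm convergence of the Cesaro means\<close>

theorem corollary6p5:
  assumes "positive_schur_property TYPE('a::banach_lattice)"
  shows "weak_banach_saks_property TYPE('a)"
  unfolding weak_banach_saks_property_def
proof (intro allI impI)
  note schur = assms
  fix x :: "nat \<Rightarrow> 'a"
  assume x: "weakly_convergent_to x 0"
  obtain W where W: "0 \<le> W"
    and dom: "\<And>e. 0 < e \<Longrightarrow> \<exists>R::nat. \<forall>n. norm (pprt (\<bar>x n\<bar> - real R *\<^sub>R W)) \<le> e"
    using schur_weakly_null_dominated[OF schur x] by blast
  obtain f where f: "positive_functional f"
    and fW: "\<And>z. (\<And>n. 0 \<le> z n) \<Longrightarrow> (\<And>n. z n \<le> W) \<Longrightarrow> (\<lambda>n. f (z n)) \<longlonglongrightarrow> 0 \<Longrightarrow> z \<longlonglongrightarrow> 0"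
    using schur_interval_functional[OF schur W] by blast
  have flin: "linear f" using f by (simp add: positive_functional_def bounded_linear.linear)
  obtain r where r: "strict_mono r"
    and sel: "\<And>n l. l \<le> n \<Longrightarrow>
      \<bar>band_functional f (pprt ((\<Sum>k<n. x (r k)) - real l *\<^sub>R W)) (x (r n))\<bar> \<le> 1 / real (Suc n)"
    "\<And>n l. l \<le> n \<Longrightarrow>
      \<bar>band_functional f (pprt (- (\<Sum>k<n. x (r k)) - real l *\<^sub>R W)) (x (r n))\<bar> \<le> 1 / real (Suc n)"
    using select_subsequence[OF x f, where W = W] by blast
  define S where "S = (\<lambda>n. \<Sum>k<n. x (r k))"
  have fdom: "\<exists>R::nat. \<forall>n. f (pprt (\<bar>x (r n)\<bar> - real R *\<^sub>R W)) \<le> \<eta>" if "0 < \<eta>" for \<eta>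
  proof -
    obtain K where K: "0 \<le> K" "\<And>v. norm (f v) \<le> norm v * K"
      using f bounded_linear.nonneg_bounded unfolding positive_functional_def by blast
    obtain R :: nat where R: "\<And>n. norm (pprt (\<bar>x n\<bar> - real R *\<^sub>R W)) \<le> \<eta> / (1 + K)"
      using dom[of "\<eta> / (1 + K)"] \<open>0 < \<eta>\<close> K(1) by (auto simp: add_pos_nonneg)
    have "f (pprt (\<bar>x n\<bar> - real R *\<^sub>R W)) \<le> \<eta>" for n
    proof -
      have "f (pprt (\<bar>x n\<bar> - real R *\<^sub>R W)) \<le> norm (pprt (\<bar>x n\<bar> - real R *\<^sub>R W)) * K"
        using K(2)[of "pprt (\<bar>x n\<bar> - real R *\<^sub>R W)"] by simp
      also have "\<dots> \<le> \<eta> / (1 + K) * (1 + K)"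
        using K(1) that by (intro mult_mono R) auto
      also have "\<dots> = \<eta>" using K(1) by simp
      finally show ?thesis .
    qed
    then show ?thesis by blast
  qed
  have pos: "(\<lambda>n. f (pprt (S n)) / real n) \<longlonglongrightarrow> 0"
    unfolding S_def using sel(1)
    by (intro sublinear_growth_pprt[OF f W _ fdom]) (auto intro: order_trans[OF abs_ge_self])
  have neg: "(\<lambda>n. f (pprt (- S n)) / real n) \<longlonglongrightarrow> 0"
  proof -
    have "(\<lambda>n. f (pprt (\<Sum>k<n. - x (r k))) / real n) \<longlonglongrightarrow> 0"
    proof (rule sublinear_growth_pprt[OF f W])
      fix n l :: nat assume l: "l \<le> n"
      let ?G = "band_functional f (pprt (- (\<Sum>k<n. x (r k)) - real l *\<^sub>R W))"
      have "?G (- x (r n)) = - ?G (x (r n))"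
        using positive_band_functional[OF f zero_le_pprt]
        by (simp add: positive_functional_def linear_neg bounded_linear.linear)
      then show "band_functional f (pprt ((\<Sum>k<n. - x (r k)) - real l *\<^sub>R W)) (- x (r n)) \<le> 1 / real (Suc n)"
        using sel(2)[OF l] by (simp add: sum_negf)
    qed (use fdom in simp)
    then show ?thesis by (simp add: S_def sum_negf)
  qed
  define A where "A = (\<lambda>n. (1 / real n) *\<^sub>R \<bar>S n\<bar>)"
  have A0: "0 \<le> A n" for n unfolding A_def by (intro scaleR_nonneg_nonneg) auto
  have fA: "(\<lambda>n. f (A n)) \<longlonglongrightarrow> 0"
  proof -
    have "f (A n) = f (pprt (S n)) / real n + f (pprt (- S n)) / real n" for n
      unfolding A_def pprt_plus_pprt_uminus[symmetric]
      by (simp add: linear_add[OF flin] linear_scale[OF flin] add_divide_distrib scaleR_add_right)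
    then show ?thesis using tendsto_add[OF pos neg] by simp
  qed
  have "A \<longlonglongrightarrow> 0"
  proof (rule LIMSEQ_I)
    fix e :: real assume e: "0 < e"
    then obtain R :: nat where R: "\<And>n. norm (pprt (\<bar>x n\<bar> - real R *\<^sub>R W)) \<le> e/2"
      using dom[of "e/2"] by auto
    \<comment> \<open>The factor \<open>Suc R\<close> is positive even if \<open>R = 0\<close>, so
      \<open>inf (A n) u\<close> can be scaled back into the interval \<open>{0..W}\<close> on which
      \<open>f\<close> detects norm convergence.\<close>
    define u where "u = real (Suc R) *\<^sub>R W"
    have u: "0 \<le> u" unfolding u_def by (intro scaleR_nonneg_nonneg W) simp
    have Ru: "real R *\<^sub>R W \<le> u" unfolding u_def by (intro scaleR_right_mono W) simp
    define z where "z = (\<lambda>n. (1 / real (Suc R)) *\<^sub>R inf (A n) u)"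
    have zA: "z n \<le> A n" for n
    proof -
      have "z n \<le> 1 *\<^sub>R inf (A n) u" unfolding z_def using A0 u by (intro scaleR_right_mono) auto
      then show ?thesis by (simp add: le_infI1)
    qed
    have z0: "0 \<le> z n" for n unfolding z_def using A0 u by (intro scaleR_nonneg_nonneg) auto
    have "z \<longlonglongrightarrow> 0"
    proof (rule fW[OF z0])
      show "z n \<le> W" for n
      proof -
        have "z n \<le> (1 / real (Suc R)) *\<^sub>R u" unfolding z_def by (intro scaleR_left_mono) auto
        then show ?thesis by (simp add: u_def)
      qed
      show "(\<lambda>n. f (z n)) \<longlonglongrightarrow> 0"
      proof (rule tendsto_sandwich[OF _ _ tendsto_const fA])
        show "eventually (\<lambda>n. 0 \<le> f (z n)) sequentially"
          using f z0 by (simp add: positive_functional_def)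
        show "eventually (\<lambda>n. f (z n) \<le> f (A n)) sequentially"
          by (intro always_eventually allI positive_functional_mono[OF f zA])
      qed
    qed
    then have "(\<lambda>n. real (Suc R) *\<^sub>R z n) \<longlonglongrightarrow> real (Suc R) *\<^sub>R 0" by (intro tendsto_scaleR tendsto_const)
    then have "(\<lambda>n. inf (A n) u) \<longlonglongrightarrow> 0" by (simp add: z_def)
    from LIMSEQ_D[OF this, of "e/2"] e obtain N where N: "\<And>n. N \<le> n \<Longrightarrow> norm (inf (A n) u) < e/2" by auto
    \<comment> \<open>The excess of an average over \<open>u\<close> is at most the average of the
      excesses, each of norm at most \<open>e/2\<close>. For \<open>n = 0\<close> the average is 0
      because \<open>1 / 0 = 0\<close>.\<close>
    have rest: "norm (pprt (A n - u)) \<le> e/2" for n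
    proof (cases "n = 0")
      case True
      then show ?thesis using u e by (simp add: A_def)
    next
      case False
      let ?p = "\<Sum>k<n. pprt (\<bar>x (r k)\<bar> - u)"
      have "\<bar>S n\<bar> \<le> (\<Sum>k<n. \<bar>x (r k)\<bar>)" unfolding S_def by (rule sum_abs)
      also have "\<dots> \<le> (\<Sum>k<n. pprt (\<bar>x (r k)\<bar> - u) + u)"
        by (intro sum_mono) (simp only: pprt_ge_self flip: diff_le_eq)
      also have "\<dots> = ?p + real n *\<^sub>R u" by (simp add: sum.distrib sum_constant_scaleR)
      finally have "A n \<le> (1 / real n) *\<^sub>R (?p + real n *\<^sub>R u)"
        unfolding A_def by (intro scaleR_left_mono) auto
      then have "A n - u \<le> (1 / real n) *\<^sub>R ?p"
        using False by (simp add: scaleR_add_right algebra_simps)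
      then have "pprt (A n - u) \<le> (1 / real n) *\<^sub>R ?p"
        by (intro pprt_leI scaleR_nonneg_nonneg sum_nonneg) auto
      then have "norm (pprt (A n - u)) \<le> norm ((1 / real n) *\<^sub>R ?p)"
        by (intro norm_mono_nonneg) auto
      also have "\<dots> = (1 / real n) * norm ?p" by simp
      also have "\<dots> \<le> (1 / real n) * (\<Sum>k<n. e/2)"
      proof (intro mult_left_mono sum_norm_le)
        fix k
        have "norm (pprt (\<bar>x (r k)\<bar> - u)) \<le> norm (pprt (\<bar>x (r k)\<bar> - real R *\<^sub>R W))"
          using Ru by (intro norm_mono_nonneg pprt_mono diff_left_mono) auto
        then show "norm (pprt (\<bar>x (r k)\<bar> - u)) \<le> e/2" using R[of "r k"] by simp
      qed simp
      also have "\<dots> = e/2" using False by simp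
      finally show ?thesis .
    qed
    show "\<exists>N. \<forall>n\<ge>N. norm (A n - 0) < e"
    proof (intro exI[of _ N] allI impI)
      fix n assume n: "N \<le> n"
      have "A n = inf (A n) u + pprt (A n - u)" using diff_inf_eq_pprt[of "A n" u] by (metis add.commute diff_add_cancel)
      then have "norm (A n) \<le> norm (inf (A n) u) + norm (pprt (A n - u))" by (metis norm_triangle_ineq)
      then show "norm (A n - 0) < e" using N[OF n] rest[of n] by simp
    qed
  qed
  moreover have "norm (cesaro_mean (x \<circ> r) n) \<le> norm (A n)" for n
    unfolding cesaro_mean_def A_def S_def norm_scaleR norm_abs o_def by simp
  ultimately have "cesaro_mean (x \<circ> r) \<longlonglongrightarrow> 0"
    using tendsto_norm_zero_bound[of "cesaro_mean (x \<circ> r)" "\<lambda>n. norm (A n)"] tendsto_norm_zero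
    by blast
  then show "\<exists>r. strict_mono r \<and> convergent (cesaro_mean (x \<circ> r))"
    using r by (auto simp: convergent_def)
qed

end
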